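(* Let $f$ be a real-valued differentiable function on $[1,\infty)$ satisfying the following conditions: (1) the limit $\lim_{n\to\infty}\dfrac{\int_1^n B(t)f'(t)\,dt}{B(n)f(n)}$ (which exists, finite or infinite) is not equal to $1$; (2) $f(x)$ is monotone and $f'(x)\ne 0$; (3) $\lim_{n\to\infty}\int_1^n B(t)f'(t)\,dt=\pm\infty$ (that is, the limit is $+\infty$ or $-\infty$). Then $$\lim_{n\to\infty}\frac{\sum_{k=1}^n a_k f(k)}{\sum_{k=1}^n b_k f(k)}=1 .$$
   Context: Here $a_k=1$ if $k$ is prime and $a_k=0$ otherwise; $b_1=0$ and $b_k=\frac{1}{\ln k}$ for integers $k\ge2$. For real $t\ge 1$, $A(t)=\sum_{k\le t}a_k$ and $B(t)=\sum_{k\le t}b_k$. One has $\lim_{n\to\infty}A(n)/B(n)=1$ (prime number theorem). *)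

theory Defs
  imports "HOL-Analysis.Analysis" "HOL-Computational_Algebra.Primes"
begin

definition a :: "nat \<Rightarrow> real" where
  "a k = (if prime k then 1 else 0)"

definition b :: "nat \<Rightarrow> real" where
  "b k = (if k \<ge> 2 then 1 / ln (real k) else 0)"

definition B :: "real \<Rightarrow> real" where
  "B t = (\<Sum>k\<in>{1..nat \<lfloor>t\<rfloor>}. b k)"

end

theory Submission
  imports Defs "HOL-Complex_Analysis.Complex_Analysis" "HOL-Number_Theory.Prime_Powers"
    "HOL-Real_Asymp.Real_Asymp"
begin

text \<open>
  Write \<open>A\<close> and \<open>B\<close> for the summatory functions of \<open>a\<close> and \<open>b\<close>. Summation by parts turns both sides
  into \<open>\<Sum>k\<le>n. a k * f k = A n * f n - J n\<close> and \<open>\<Sum>k\<le>n. b k * f k = B n * f n - I n\<close>, where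
  \<open>I n = \<Sum>k<n. B k * (f (k+1) - f k)\<close> is the integral of \<open>B * f'\<close> over \<open>[1,n]\<close> and \<open>J n\<close> is the same
  sum for \<open>A\<close>. Since \<open>f\<close> is monotone, all increments of \<open>f\<close> have one sign, so \<open>\<bar>I n\<bar> \<longrightarrow> \<infinity>\<close> together with
  \<open>A n / B n \<longrightarrow> 1\<close> forces \<open>J n / I n \<longrightarrow> 1\<close> (\<open>monotone_weights_ratio\<close>). Two quotients tending to 1 pass to
  the quotient of differences as soon as no cancellation happens in the denominator, that is, as soon as
  \<open>I n / (B n * f n)\<close> stays away from 1, which the hypothesis on its limit ensures
  (\<open>ratio_of_differences\<close>).

  The arithmetic input is \<open>A n / B n \<longrightarrow> 1\<close>, the prime number theorem, and most of the text proves it, by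
  Newman's method. With \<open>\<Lambda>\<close> the von Mangoldt function, \<open>\<psi>\<close> its summatory function and
  \<open>E n = \<psi> n - n\<close>, the Dirichlet series of \<open>\<Lambda> n - 1\<close> equals \<open>- \<zeta>'/\<zeta> - \<zeta>\<close>. The poles at 1 cancel, and
  \<open>\<zeta>\<close> has no zero with real part at least 1 (\<open>zeta_reg_nonzero\<close>), so this function extends
  holomorphically across the line of real part 1. As \<open>E n = O(n)\<close> (\<open>psi_le\<close>, Chebyshev), Newman's
  contour argument (\<open>newman_tauberian\<close>) shows that \<open>\<Sum>n. E n / (n * (n + 1))\<close> converges. Because \<open>\<psi>\<close> is
  monotone, convergence is impossible unless \<open>\<psi> n / n \<longrightarrow> 1\<close> (\<open>asymp_of_summable_deviation\<close>). Discarding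
  the proper prime powers and dividing by \<open>ln\<close> through summation by parts gives \<open>A n / B n \<longrightarrow> 1\<close>
  directly in terms of \<open>B n = \<Sum>k\<le>n. 1 / ln k\<close>, with no detour through the logarithmic integral.
\<close>

section \<open>Newman's Tauberian theorem\<close>

text \<open>
  Integration by parts gains the factor \<open>1 / T\<close>: on a path in the left half plane
  \<open>exp (T * z)\<close> has norm at most 1, so the boundary term and the integral of \<open>h' * exp (T * z)\<close> stay
  bounded. The hypothesis \<open>L\<close> says that the path has finite length.
\<close>
lemma contour_integral_exp_decay:
  fixes h :: "complex \<Rightarrow> complex"
  assumes h: "h holomorphic_on V" and V: "open V"
    and \<gamma>: "valid_path \<gamma>" "path_image \<gamma> \<subseteq> V" "path_image \<gamma> \<subseteq> {z. Re z \<le> 0}"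
    and L: "\<And>f B. continuous_on (path_image \<gamma>) f \<Longrightarrow> 0 \<le> B \<Longrightarrow>
              (\<And>z. z \<in> path_image \<gamma> \<Longrightarrow> norm (f z) \<le> B) \<Longrightarrow> norm (contour_integral \<gamma> f) \<le> L * B"
  shows "((\<lambda>T. contour_integral \<gamma> (\<lambda>z. h z * exp (of_real T * z))) \<longlongrightarrow> 0) at_top"
proof -
  have h': "deriv h holomorphic_on V"
    using h V by (rule holomorphic_deriv)
  have cpt: "compact (path_image \<gamma>)"
    using \<gamma>(1) by (simp add: compact_path_image valid_path_imp_path)
  have "continuous_on (path_image \<gamma>) h" "continuous_on (path_image \<gamma>) (deriv h)"
    using h h' \<gamma>(2) by (meson continuous_on_subset holomorphic_on_imp_continuous_on)+
  then have "bounded (h ` path_image \<gamma>)" "bounded (deriv h ` path_image \<gamma>)"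
    using cpt by (simp_all add: compact_continuous_image compact_imp_bounded)
  then obtain M M' where "\<forall>z\<in>path_image \<gamma>. norm (h z) \<le> M" "\<forall>z\<in>path_image \<gamma>. norm (deriv h z) \<le> M'"
    unfolding bounded_iff by auto
  then have M: "norm (h z) \<le> M" and M': "norm (deriv h z) \<le> M'" if "z \<in> path_image \<gamma>" for z
    using that by auto
  have ends: "pathstart \<gamma> \<in> path_image \<gamma>" "pathfinish \<gamma> \<in> path_image \<gamma>" by auto
  have M0: "0 \<le> M" "0 \<le> M'"
    using M[OF ends(1)] M'[OF ends(1)] norm_ge_zero order_trans by blast+
  have ex: "norm (exp (of_real T * z)) \<le> 1" if "T \<ge> 0" "z \<in> path_image \<gamma>" for T z
    using that \<gamma>(3) by (auto simp: mult_nonneg_nonpos)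
  have le: "norm (contour_integral \<gamma> (\<lambda>z. h z * exp (of_real T * z))) \<le> (2 * M + L * M') / T" if T: "T > 0" for T
  proof -
    let ?e = "\<lambda>z. exp (of_real T * z)"
    have d: "((\<lambda>z. h z * ?e z) has_field_derivative (deriv h z * ?e z + of_real T * (h z * ?e z))) (at z within V)"
      if "z \<in> V" for z
      using h V that by (auto intro!: derivative_eq_intros holomorphic_derivI simp: algebra_simps)
    have i0: "((\<lambda>z. deriv h z * ?e z + of_real T * (h z * ?e z)) has_contour_integral
          (h (pathfinish \<gamma>) * ?e (pathfinish \<gamma>) - h (pathstart \<gamma>) * ?e (pathstart \<gamma>))) \<gamma>"
      by (rule contour_integral_primitive[OF d \<gamma>(1,2)])
    have ci: "(\<lambda>z. deriv h z * ?e z) contour_integrable_on \<gamma>" "(\<lambda>z. h z * ?e z) contour_integrable_on \<gamma>"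
      using h h' V \<gamma> by (auto intro!: contour_integrable_holomorphic_simple[of _ V] holomorphic_intros)
    have "contour_integral \<gamma> (\<lambda>z. deriv h z * ?e z) + of_real T * contour_integral \<gamma> (\<lambda>z. h z * ?e z)
        = h (pathfinish \<gamma>) * ?e (pathfinish \<gamma>) - h (pathstart \<gamma>) * ?e (pathstart \<gamma>)"
      using contour_integral_unique[OF i0] ci
      by (simp add: contour_integral_add contour_integral_lmul contour_integrable_lmul)
    then have eq: "of_real T * contour_integral \<gamma> (\<lambda>z. h z * ?e z) =
        h (pathfinish \<gamma>) * ?e (pathfinish \<gamma>) - h (pathstart \<gamma>) * ?e (pathstart \<gamma>)
          - contour_integral \<gamma> (\<lambda>z. deriv h z * ?e z)"
      by (simp add: algebra_simps)
    have b1: "norm (h z * ?e z) \<le> M" if "z \<in> path_image \<gamma>" for z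
      using mult_mono[OF M[OF that] ex[OF less_imp_le[OF T] that] M0(1) norm_ge_zero] by (simp add: norm_mult)
    have b2: "norm (deriv h z * ?e z) \<le> M'" if "z \<in> path_image \<gamma>" for z
      using mult_mono[OF M'[OF that] ex[OF less_imp_le[OF T] that] M0(2) norm_ge_zero] by (simp add: norm_mult)
    have "continuous_on (path_image \<gamma>) (\<lambda>z. deriv h z * ?e z)"
      using h' \<gamma>(2) by (auto intro!: continuous_intros intro: continuous_on_subset holomorphic_on_imp_continuous_on)
    then have "norm (contour_integral \<gamma> (\<lambda>z. deriv h z * ?e z)) \<le> L * M'"
      by (rule L[OF _ M0(2) b2])
    then have "T * norm (contour_integral \<gamma> (\<lambda>z. h z * ?e z)) \<le> M + M + L * M'"
      using b1[OF ends(1)] b1[OF ends(2)] arg_cong[OF eq, of norm] T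
        norm_triangle_ineq4[of "h (pathfinish \<gamma>) * ?e (pathfinish \<gamma>) - h (pathstart \<gamma>) * ?e (pathstart \<gamma>)"
          "contour_integral \<gamma> (\<lambda>z. deriv h z * ?e z)"]
        norm_triangle_ineq4[of "h (pathfinish \<gamma>) * ?e (pathfinish \<gamma>)" "h (pathstart \<gamma>) * ?e (pathstart \<gamma>)"]
      by (simp add: norm_mult del: norm_exp_eq_Re)
    then show ?thesis using T by (simp add: field_simps)
  qed
  have "((\<lambda>T::real. (2 * M + L * M') / T) \<longlongrightarrow> 0) at_top"
    by (rule tendsto_divide_0[OF tendsto_const]) (simp add: filterlim_at_top_imp_at_infinity filterlim_ident)
  moreover have "\<forall>\<^sub>F T in at_top. norm (contour_integral \<gamma> (\<lambda>z. h z * exp (of_real T * z))) \<le> (2 * M + L * M') / T"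
    using eventually_gt_at_top[of 0] by eventually_elim (rule le)
  ultimately show ?thesis
    by (rule Lim_null_comparison[rotated])
qed

text \<open>
  Cauchy's formula at the centre of a circle, with the circle cut into its right and left halves
  because Newman's argument estimates the two halves differently. The difference quotient of \<open>f\<close> at 0
  is entire, so its contributions telescope, and \<open>1 / z\<close> contributes \<open>\<pi> * \<i>\<close> on each half.
\<close>
lemma half_circle_sum_Cauchy:
  fixes f :: "complex \<Rightarrow> complex"
  assumes f: "f holomorphic_on UNIV" and R: "R > 0"
  shows "contour_integral (part_circlepath 0 R (-pi/2) (pi/2)) (\<lambda>z. f z / z)
       + contour_integral (part_circlepath 0 R (pi/2) (3*pi/2)) (\<lambda>z. f z / z) = 2 * of_real pi * \<i> * f 0"
proof -
  define h where "h = (\<lambda>z. if z = 0 then deriv f 0 else (f z - f 0) / (z - 0))"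
  have h: "h holomorphic_on UNIV"
    unfolding h_def by (rule pole_lemma_open[OF f]) auto
  obtain H where H: "\<And>z. (H has_field_derivative h z) (at z)"
    using holomorphic_convex_primitive'[OF convex_UNIV open_UNIV h] by auto
  have arc: "contour_integral (part_circlepath 0 R s t) (\<lambda>z. f z / z)
      = H (of_real R * exp (\<i> * t)) - H (of_real R * exp (\<i> * s)) + f 0 * (\<i> * of_real (t - s))" if "s < t" for s t
  proof -
    have nz: "z \<noteq> 0" if "z \<in> path_image (part_circlepath 0 R s t)" for z
      using in_path_image_part_circlepath[OF that less_imp_le[OF \<open>s < t\<close>]] R by auto
    have 1: "(h has_contour_integral (H (of_real R * exp (\<i> * t)) - H (of_real R * exp (\<i> * s)))) (part_circlepath 0 R s t)"
      using contour_integral_primitive[of UNIV H h "part_circlepath 0 R s t"] H by (simp add: exp_eq_polar)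
    have 2: "((\<lambda>z. f 0 * (1 / z)) has_contour_integral (f 0 * (\<i> * of_real (t - s)))) (part_circlepath 0 R s t)"
    proof (rule has_contour_integral_lmul)
      show "((\<lambda>z. 1 / z) has_contour_integral (\<i> * of_real (t - s))) (part_circlepath 0 R s t)"
        unfolding has_contour_integral_part_circlepath_iff[OF \<open>s < t\<close>]
      proof (rule has_integral_eq)
        show "((\<lambda>x. \<i>) has_integral \<i> * of_real (t - s)) {s..t}"
          using has_integral_const_real[of \<i> s t] \<open>s < t\<close> by (simp add: scaleR_conv_of_real mult.commute)
        show "\<i> = 1 / (0 + of_real R * cis x) * of_real R * \<i> * cis x" for x
          using R by (simp add: field_simps)
      qed
    qed
    have "((\<lambda>z. f z / z) has_contour_integral (H (of_real R * exp (\<i> * t)) - H (of_real R * exp (\<i> * s)) + f 0 * (\<i> * of_real (t - s)))) (part_circlepath 0 R s t)"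
      by (rule has_contour_integral_eq[OF has_contour_integral_add[OF 1 2]])
         (use nz in \<open>auto simp: h_def field_simps\<close>)
    then show ?thesis by (rule contour_integral_unique)
  qed
  have "exp (\<i> * of_real (3*pi/2)) = exp (\<i> * of_real (-pi/2))"
    using cos_periodic[of "-pi/2"] sin_periodic[of "-pi/2"]
    by (simp add: exp_eq_polar complex_eq_iff add_divide_distrib[symmetric])
  then show ?thesis
    by (simp add: arc algebra_simps)
qed

text \<open>
  Newman's kernel: on the circle it is real and proportional to \<open>Re z\<close>, which cancels the
  factor \<open>1 / Re z\<close> in the bounds for the partial sums and the remainders.
\<close>
lemma newman_kernel_on_circle:
  assumes "norm z = R" "R > 0"
  shows "(1 + z^2 / of_real R ^ 2) / z = of_real (2 * Re z / R ^ 2)"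
proof -
  have z: "z \<noteq> 0" using assms by auto
  have "of_real R ^ 2 = z * cnj z"
    using assms(1) by (metis complex_norm_square of_real_power)
  then have "1 + z^2 / of_real R ^ 2 = z * (z + cnj z) / of_real R ^ 2"
    using assms(2) z by (simp add: field_simps power2_eq_square)
  also have "z + cnj z = of_real (2 * Re z)" by (simp add: complex_add_cnj)
  finally show ?thesis using z by simp
qed

lemma half_circle_Re:
  assumes "R > 0"
  shows "z \<in> path_image (part_circlepath 0 R (-pi/2) (pi/2)) \<Longrightarrow> norm z = R \<and> Re z \<ge> 0"
    and "z \<in> path_image (part_circlepath 0 R (pi/2) (3*pi/2)) \<Longrightarrow> norm z = R \<and> Re z \<le> 0"
proof -
  assume "z \<in> path_image (part_circlepath 0 R (-pi/2) (pi/2))"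
  then obtain x where "z = of_real R * exp (\<i> * of_real x)" "-pi/2 \<le> x" "x \<le> pi/2"
    by (auto simp: path_image_part_circlepath)
  then show "norm z = R \<and> Re z \<ge> 0"
    using assms cos_ge_zero[of x] by (auto simp: norm_mult Re_exp)
next
  assume "z \<in> path_image (part_circlepath 0 R (pi/2) (3*pi/2))"
  then obtain x where x: "z = of_real R * exp (\<i> * of_real x)" "pi/2 \<le> x" "x \<le> 3*pi/2"
    by (auto simp: path_image_part_circlepath)
  have "cos (x - pi) \<ge> 0" using x by (intro cos_ge_zero) auto
  then have "cos x \<le> 0" by (simp add: cos_diff)
  then show "norm z = R \<and> Re z \<le> 0"
    using assms x by (auto simp: norm_mult Re_exp mult_nonneg_nonpos)
qed

text \<open>
  Newman's Tauberian theorem for a series of entire functions. The bound on \<open>u n\<close> is what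
  \<open>\<bar>u n z\<bar> \<le> C * (integral of exp (- t * Re z) over [l n, l (n+1)])\<close> amounts to, so the series behaves
  like the Laplace transform of a bounded function cut into pieces at the points \<open>l n\<close>. Working with
  the pieces keeps every partial sum entire and makes the bounds telescope.

  For the partial sum \<open>S N\<close>, write \<open>S N 0 - g 0\<close> by Cauchy's formula on a circle of radius \<open>R\<close>
  with the kernel \<open>exp (T * z) * (1 + z\<^sup>2 / R\<^sup>2) / z\<close>, \<open>T = l N\<close>. On the right half, \<open>S N - g\<close> contributes
  at most a multiple of \<open>C / R\<close>, and so does \<open>S N\<close> on the left half. What is left is \<open>g - g 0\<close> on the
  right half and the constant \<open>g 0\<close> on the left half. The former can be moved to the vertical diameter,
  where \<open>(g - g 0) / z\<close> is still holomorphic; both then tend to 0 by \<open>contour_integral_exp_decay\<close>.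
\<close>
theorem newman_tauberian:
  fixes u :: "nat \<Rightarrow> complex \<Rightarrow> complex" and l :: "nat \<Rightarrow> real" and g :: "complex \<Rightarrow> complex"
  assumes holu: "\<And>n. u n holomorphic_on UNIV"
    and l0: "l 0 = 0" and l_lim: "filterlim l at_top sequentially"
    and C: "C \<ge> 0"
    and bound: "\<And>n z. Re z \<noteq> 0 \<Longrightarrow>
        norm (u n z) \<le> C * ((exp (- Re z * l n) - exp (- Re z * l (Suc n))) / Re z)"
    and U: "open U" "{z. Re z \<ge> 0} \<subseteq> U" and holg: "g holomorphic_on U"
    and sums: "\<And>z. Re z > 0 \<Longrightarrow> (\<lambda>n. u n z) sums g z"
  shows "(\<lambda>n. u n 0) sums g 0"
proof -
  define S where "S = (\<lambda>N z. \<Sum>n<N. u n z)"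
  have holS: "S N holomorphic_on A" for N A
    unfolding S_def by (intro holomorphic_intros holomorphic_on_subset[OF holu]) auto
  have block: "norm (\<Sum>n\<in>{N..<M}. u n z) \<le> C * ((exp (- Re z * l N) - exp (- Re z * l M)) / Re z)"
    if "Re z \<noteq> 0" "N \<le> M" for N M z
  proof -
    have "norm (\<Sum>n\<in>{N..<M}. u n z) \<le> (\<Sum>n\<in>{N..<M}. C * ((exp (- Re z * l n) - exp (- Re z * l (Suc n))) / Re z))"
      using that(1) by (intro sum_norm_le bound)
    also have "\<dots> = C * ((\<Sum>n\<in>{N..<M}. exp (- Re z * l n) - exp (- Re z * l (Suc n))) / Re z)"
      by (simp only: sum_distrib_left sum_divide_distrib)
    also have "(\<Sum>n\<in>{N..<M}. exp (- Re z * l n) - exp (- Re z * l (Suc n))) = exp (- Re z * l N) - exp (- Re z * l M)"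
      using sum_Suc_diff'[OF that(2), of "\<lambda>n. - exp (- Re z * l n)"] by simp
    finally show ?thesis .
  qed
  have left: "norm (S N z) \<le> C * (exp (- Re z * l N) / (- Re z))" if "Re z < 0" for N z
  proof -
    have "norm (S N z) \<le> C * ((exp (- Re z * l 0) - exp (- Re z * l N)) / Re z)"
      using block[of z 0 N] that by (simp add: S_def atLeast0LessThan)
    also have "\<dots> \<le> C * (exp (- Re z * l N) / (- Re z))"
      using that C l0 by (intro mult_left_mono) (auto simp: field_simps)
    finally show ?thesis .
  qed
  have right: "norm (S N z - g z) \<le> C * (exp (- Re z * l N) / Re z)" if "Re z > 0" for N z
  proof -
    have "(\<lambda>M. S N z - S M z) \<longlonglongrightarrow> S N z - g z"
      using sums[OF that] by (intro tendsto_intros) (simp add: sums_def S_def)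
    moreover have "\<forall>\<^sub>F M in sequentially. norm (S N z - S M z) \<le> C * (exp (- Re z * l N) / Re z)"
      using eventually_ge_at_top[of N]
    proof eventually_elim
      case (elim M)
      have "{..<M} = {..<N} \<union> {N..<M}" using elim by auto
      then have "S M z - S N z = (\<Sum>n\<in>{N..<M}. u n z)"
        unfolding S_def by (simp add: sum.union_disjoint ivl_disj_int)
      then have "norm (S N z - S M z) \<le> C * ((exp (- Re z * l N) - exp (- Re z * l M)) / Re z)"
        using block[of z N M] elim that by (simp add: norm_minus_commute)
      also have "\<dots> \<le> C * (exp (- Re z * l N) / Re z)"
        using that C by (intro mult_left_mono divide_right_mono) auto
      finally show ?case .
    qed
    ultimately show ?thesis
      by (intro Lim_norm_ubound[OF sequentially_bot])
  qed
  have "(\<lambda>N. S N 0) \<longlonglongrightarrow> g 0"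
    unfolding tendsto_iff
  proof (intro allI impI)
    fix e :: real assume e: "e > 0"
    \<comment> \<open>The two arcs contribute \<open>2 * C / R\<close> in total; this \<open>R\<close> makes that less than \<open>e / 2\<close>.\<close>
    define R where "R = 4 * (C + 1) / e"
    have R: "R > 0" using C e by (simp add: R_def)
    have CR: "2 * C / R < e / 2" using C e by (simp add: R_def field_simps)
    define \<gamma>1 where "\<gamma>1 = part_circlepath 0 R (-pi/2) (pi/2)"
    define \<gamma>2 where "\<gamma>2 = part_circlepath 0 R (pi/2) (3*pi/2)"
    define \<sigma> where "\<sigma> = linepath (- \<i> * of_real R) (\<i> * of_real R)"
    define K where "K = (\<lambda>z::complex. 1 + z^2 / of_real R ^ 2)"
    define ex where "ex = (\<lambda>T z::complex. exp (of_real T * z))"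
    have \<gamma>1: "norm z = R" "Re z \<ge> 0" "z \<noteq> 0" "z \<in> U" if "z \<in> path_image \<gamma>1" for z
      using half_circle_Re(1)[OF R that[unfolded \<gamma>1_def]] R U(2) by auto
    have \<gamma>2: "norm z = R" "Re z \<le> 0" "z \<noteq> 0" if "z \<in> path_image \<gamma>2" for z
      using half_circle_Re(2)[OF R that[unfolded \<gamma>2_def]] R by auto
    have vp: "valid_path \<gamma>1" "valid_path \<gamma>2" "valid_path \<sigma>"
      by (auto simp: \<gamma>1_def \<gamma>2_def \<sigma>_def)
    define q where "q = (\<lambda>z. (if z = 0 then deriv g 0 else (g z - g 0) / (z - 0)) * K z)"
    have holq: "q holomorphic_on U"
      unfolding q_def K_def using R by (intro holomorphic_intros pole_lemma_open holg U) auto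
    have holK: "K holomorphic_on A" "ex T holomorphic_on A" for A T
      unfolding K_def ex_def using R by (auto intro!: holomorphic_intros)
    have contK: "continuous_on A K" "continuous_on A (ex T)" "continuous_on A (S N)" for A T N
      using holK holS holomorphic_on_imp_continuous_on by blast+
    have contg: "continuous_on A g" if "A \<subseteq> U" for A
      using holg that by (meson continuous_on_subset holomorphic_on_imp_continuous_on)
    have int1: "f contour_integrable_on \<gamma>1" if "continuous_on (path_image \<gamma>1) f" for f
      using that unfolding \<gamma>1_def by (rule contour_integrable_continuous_part_circlepath)
    have int2: "f contour_integrable_on \<gamma>2" if "continuous_on (path_image \<gamma>2) f" for f
      using that unfolding \<gamma>2_def by (rule contour_integrable_continuous_part_circlepath)
    have bd1: "norm (contour_integral \<gamma>1 f) \<le> R * pi * M" if "continuous_on (path_image \<gamma>1) f" "0 \<le> M"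
        "\<And>z. z \<in> path_image \<gamma>1 \<Longrightarrow> norm (f z) \<le> M" for f M
      using contour_integral_bound_part_circlepath[of f 0 R "-pi/2" "pi/2" M] int1[OF that(1)] that R
      by (simp add: \<gamma>1_def mult_ac)
    have bd2: "norm (contour_integral \<gamma>2 f) \<le> R * pi * M" if "continuous_on (path_image \<gamma>2) f" "0 \<le> M"
        "\<And>z. z \<in> path_image \<gamma>2 \<Longrightarrow> norm (f z) \<le> M" for f M
      using contour_integral_bound_part_circlepath[of f 0 R "pi/2" "3*pi/2" M] int2[OF that(1)] that R
      by (simp add: \<gamma>2_def mult_ac)
    have bd\<sigma>: "norm (contour_integral \<sigma> f) \<le> (2 * R) * M" if "continuous_on (path_image \<sigma>) f" "0 \<le> M"
        "\<And>z. z \<in> path_image \<sigma> \<Longrightarrow> norm (f z) \<le> M" for f M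
    proof -
      have "f contour_integrable_on \<sigma>"
        using that(1) unfolding \<sigma>_def path_image_linepath by (rule contour_integrable_continuous_linepath)
      then have "norm (contour_integral \<sigma> f) \<le> M * norm (\<i> * of_real R - (- \<i> * of_real R))"
        using that(2,3) unfolding \<sigma>_def path_image_linepath by (rule contour_integral_bound_linepath)
      also have "norm (\<i> * of_real R - (- \<i> * of_real R)) = 2 * R"
        using R by (simp flip: mult_2 add: norm_mult)
      finally show ?thesis by (simp add: mult_ac)
    qed
    have shift: "contour_integral \<gamma>1 f = contour_integral \<sigma> f" if f: "f holomorphic_on U" for f
    proof -
      let ?H = "{z. Re z \<ge> 0}"
      have H: "convex ?H" by (simp add: convex_halfspace_Re_ge)
      have "f field_differentiable at z" if "z \<in> interior ?H - {}" for z
        using f U that interior_subset by (intro holomorphic_on_imp_differentiable_at[OF f U(1)]) blast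
      moreover have "continuous_on ?H f"
        using f U(2) by (meson continuous_on_subset holomorphic_on_imp_continuous_on)
      ultimately obtain F where F: "\<And>z. z \<in> ?H \<Longrightarrow> (F has_field_derivative f z) (at z within ?H)"
        using holomorphic_convex_primitive[OF H finite.emptyI, of f] by blast
      have "contour_integral \<gamma>1 f = F (pathfinish \<gamma>1) - F (pathstart \<gamma>1)"
        by (rule contour_integral_unique[OF contour_integral_primitive[OF F]]) (use vp \<gamma>1 in auto)
      moreover have "path_image \<sigma> \<subseteq> ?H"
        by (auto simp: \<sigma>_def closed_segment_def)
      then have "contour_integral \<sigma> f = F (pathfinish \<sigma>) - F (pathstart \<sigma>)"
        by (intro contour_integral_unique[OF contour_integral_primitive[OF F]]) (use vp in auto)
      moreover have "pathfinish \<sigma> = pathfinish \<gamma>1" "pathstart \<sigma> = pathstart \<gamma>1"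
        by (auto simp: \<sigma>_def \<gamma>1_def exp_eq_polar complex_eq_iff)
      ultimately show ?thesis by simp
    qed
    have I2: "((\<lambda>T. contour_integral \<sigma> (\<lambda>z. q z * ex T z)) \<longlongrightarrow> 0) at_top"
      unfolding ex_def
    proof (rule contour_integral_exp_decay[OF holq U(1) vp(3)])
      show "path_image \<sigma> \<subseteq> U" "path_image \<sigma> \<subseteq> {z. Re z \<le> 0}"
        using U(2) by (auto simp: \<sigma>_def closed_segment_def)
    qed (rule bd\<sigma>)
    have I4: "((\<lambda>T. contour_integral \<gamma>2 (\<lambda>z. K z / z * ex T z)) \<longlongrightarrow> 0) at_top"
      unfolding ex_def
    proof (rule contour_integral_exp_decay[OF _ _ vp(2)])
      show "(\<lambda>z. K z / z) holomorphic_on (- {0})" by (intro holomorphic_intros holK) auto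
      show "path_image \<gamma>2 \<subseteq> - {0}" "path_image \<gamma>2 \<subseteq> {z. Re z \<le> 0}" using \<gamma>2 by auto
    qed (auto intro!: bd2)
    have "((\<lambda>T. norm (contour_integral \<sigma> (\<lambda>z. q z * ex T z))
        + norm (g 0) * norm (contour_integral \<gamma>2 (\<lambda>z. K z / z * ex T z))) \<longlongrightarrow> 0 + norm (g 0) * 0) at_top"
      by (intro tendsto_intros tendsto_norm_zero I2 I4)
    then have small: "\<forall>\<^sub>F T in at_top. norm (contour_integral \<sigma> (\<lambda>z. q z * ex T z))
        + norm (g 0) * norm (contour_integral \<gamma>2 (\<lambda>z. K z / z * ex T z)) < e"
      using order_tendstoD(2)[of _ _ at_top e] e by simp
    have main: "2 * pi * norm (S N 0 - g 0) \<le> 4 * pi * C / R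
        + (norm (contour_integral \<sigma> (\<lambda>z. q z * ex (l N) z))
        + norm (g 0) * norm (contour_integral \<gamma>2 (\<lambda>z. K z / z * ex (l N) z)))" for N
    proof -
      let ?e = "ex (l N)"
      let ?k = "\<lambda>z. K z / z * ?e z"
      have ne: "norm (?k z) = 2 * \<bar>Re z\<bar> / R^2 * exp (l N * Re z)" if "norm z = R" for z
        using newman_kernel_on_circle[OF that R] R
        by (simp add: K_def ex_def norm_mult abs_mult del: of_real_divide of_real_mult)
      have "contour_integral \<gamma>1 (\<lambda>z. (S N z - g 0) * K z * ?e z / z) + contour_integral \<gamma>2 (\<lambda>z. (S N z - g 0) * K z * ?e z / z)
          = 2 * of_real pi * \<i> * ((S N 0 - g 0) * K 0 * ?e 0)"
        unfolding \<gamma>1_def \<gamma>2_def by (rule half_circle_sum_Cauchy[OF _ R]) (intro holomorphic_intros holS holK)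
      then have id: "2 * of_real pi * \<i> * (S N 0 - g 0) =
          contour_integral \<gamma>1 (\<lambda>z. (S N z - g 0) * ?k z) + contour_integral \<gamma>2 (\<lambda>z. (S N z - g 0) * ?k z)"
        by (simp add: K_def ex_def mult_ac)
      have c1: "continuous_on (path_image \<gamma>1) ?k" "continuous_on (path_image \<gamma>2) ?k"
        by (intro continuous_intros contK; use \<gamma>1 \<gamma>2 in auto)+
      have cg: "continuous_on (path_image \<gamma>1) g" using \<gamma>1 by (intro contg) auto
      have "contour_integral \<gamma>1 (\<lambda>z. (S N z - g 0) * ?k z)
          = contour_integral \<gamma>1 (\<lambda>z. (S N z - g z) * ?k z + (g z - g 0) * ?k z)"
        by (rule arg_cong[where f = "contour_integral \<gamma>1"], rule ext, subst distrib_right[symmetric]) simp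
      also have "\<dots> = contour_integral \<gamma>1 (\<lambda>z. (S N z - g z) * ?k z) + contour_integral \<gamma>1 (\<lambda>z. (g z - g 0) * ?k z)"
        by (intro contour_integral_add int1 continuous_intros c1 contK cg)
      also have "contour_integral \<gamma>1 (\<lambda>z. (g z - g 0) * ?k z) = contour_integral \<gamma>1 (\<lambda>z. q z * ?e z)"
        using \<gamma>1 by (intro contour_integral_eq) (auto simp: q_def)
      also have "\<dots> = contour_integral \<sigma> (\<lambda>z. q z * ?e z)"
        by (intro shift holomorphic_intros holq holK)
      finally have e1: "contour_integral \<gamma>1 (\<lambda>z. (S N z - g 0) * ?k z) =
          contour_integral \<gamma>1 (\<lambda>z. (S N z - g z) * ?k z) + contour_integral \<sigma> (\<lambda>z. q z * ?e z)" .
      have "contour_integral \<gamma>2 (\<lambda>z. (S N z - g 0) * ?k z)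
          = contour_integral \<gamma>2 (\<lambda>z. S N z * ?k z - g 0 * ?k z)"
        by (rule arg_cong[where f = "contour_integral \<gamma>2"], rule ext, subst left_diff_distrib[symmetric]) simp
      also have "\<dots> = contour_integral \<gamma>2 (\<lambda>z. S N z * ?k z) - contour_integral \<gamma>2 (\<lambda>z. g 0 * ?k z)"
        by (intro contour_integral_diff int2 continuous_intros c1 contK)
      also have "contour_integral \<gamma>2 (\<lambda>z. g 0 * ?k z) = g 0 * contour_integral \<gamma>2 ?k"
        by (intro contour_integral_lmul int2 c1)
      finally have e2: "contour_integral \<gamma>2 (\<lambda>z. (S N z - g 0) * ?k z) =
          contour_integral \<gamma>2 (\<lambda>z. S N z * ?k z) - g 0 * contour_integral \<gamma>2 ?k" .
      have b1: "norm (contour_integral \<gamma>1 (\<lambda>z. (S N z - g z) * ?k z)) \<le> R * pi * (2 * C / R^2)"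
      proof (rule bd1)
        show "continuous_on (path_image \<gamma>1) (\<lambda>z. (S N z - g z) * ?k z)"
          by (intro continuous_intros c1 contK cg)
        fix z assume z: "z \<in> path_image \<gamma>1"
        show "norm ((S N z - g z) * ?k z) \<le> 2 * C / R^2"
        proof (cases "Re z = 0")
          case True
          then show ?thesis using ne[OF \<gamma>1(1)[OF z]] C by (simp only: norm_mult) simp
        next
          case False
          then have x: "Re z > 0" using \<gamma>1(2)[OF z] by simp
          have "norm ((S N z - g z) * ?k z) \<le> C * (exp (- Re z * l N) / Re z) * norm (?k z)"
            unfolding norm_mult[of "S N z - g z"] by (intro mult_right_mono right x) auto
          also have "\<dots> = 2 * C / R^2"
            unfolding ne[OF \<gamma>1(1)[OF z]] using x R by (simp add: field_simps exp_minus)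
          finally show ?thesis .
        qed
      qed (use C in auto)
      have b2: "norm (contour_integral \<gamma>2 (\<lambda>z. S N z * ?k z)) \<le> R * pi * (2 * C / R^2)"
      proof (rule bd2)
        show "continuous_on (path_image \<gamma>2) (\<lambda>z. S N z * ?k z)"
          by (intro continuous_intros c1 contK)
        fix z assume z: "z \<in> path_image \<gamma>2"
        show "norm (S N z * ?k z) \<le> 2 * C / R^2"
        proof (cases "Re z = 0")
          case True
          then show ?thesis using ne[OF \<gamma>2(1)[OF z]] C by (simp only: norm_mult) simp
        next
          case False
          then have x: "Re z < 0" using \<gamma>2(2)[OF z] by simp
          have "norm (S N z * ?k z) \<le> C * (exp (- Re z * l N) / (- Re z)) * norm (?k z)"
            unfolding norm_mult[of "S N z"] by (intro mult_right_mono left x) auto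
          also have "\<dots> = 2 * C / R^2"
            unfolding ne[OF \<gamma>2(1)[OF z]] using x R by (simp add: field_simps exp_minus)
          finally show ?thesis .
        qed
      qed (use C in auto)
      have "2 * pi * norm (S N 0 - g 0) = norm (2 * of_real pi * \<i> * (S N 0 - g 0))"
        by (simp add: norm_mult)
      also have "\<dots> \<le> norm (contour_integral \<gamma>1 (\<lambda>z. (S N z - g z) * ?k z)) + norm (contour_integral \<sigma> (\<lambda>z. q z * ?e z))
         + (norm (contour_integral \<gamma>2 (\<lambda>z. S N z * ?k z)) + norm (g 0 * contour_integral \<gamma>2 ?k))"
        unfolding id e1 e2 by (intro norm_triangle_mono norm_triangle_ineq norm_triangle_ineq4)
      also have "\<dots> \<le> R * pi * (2 * C / R^2) + norm (contour_integral \<sigma> (\<lambda>z. q z * ?e z))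
         + (R * pi * (2 * C / R^2) + norm (g 0 * contour_integral \<gamma>2 ?k))"
        by (intro add_mono b1 b2 order_refl)
      also have "\<dots> = 4 * pi * C / R + (norm (contour_integral \<sigma> (\<lambda>z. q z * ?e z)) + norm (g 0) * norm (contour_integral \<gamma>2 ?k))"
        using R by (simp add: norm_mult field_simps power2_eq_square)
      finally show ?thesis .
    qed
    from filterlim_iff[THEN iffD1, OF l_lim, rule_format, OF small]
    show "\<forall>\<^sub>F N in sequentially. dist (S N 0) (g 0) < e"
    proof eventually_elim
      case (elim N)
      have "2 * pi * norm (S N 0 - g 0) < 4 * pi * C / R + e"
        using main[of N] elim by linarith
      also have "\<dots> = 2 * pi * (2 * C / R) + e" by simp
      also have "\<dots> < 2 * pi * (e / 2) + pi * e"
        using CR e pi_gt3 by (intro add_less_le_mono mult_strict_left_mono) (auto simp: pi_gt_zero)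
      also have "\<dots> = 2 * pi * e" by simp
      finally show ?case by (simp add: dist_norm)
    qed
  qed
  then show ?thesis by (simp add: sums_def S_def)
qed

section \<open>The zeta function and the Dirichlet series of the von Mangoldt function\<close>

lemma norm_of_nat_powr: "norm (of_nat n powr s :: complex) = real n powr Re s"
  by (simp add: norm_powr_real_powr)

lemma has_field_derivative_of_nat_powr_minus:
  "((\<lambda>s. of_nat n powr (- s)) has_field_derivative - of_real (ln (real n)) * of_nat n powr (- s)) (at (s :: complex))"
proof (cases "n = 0")
  case False
  have "((\<lambda>s. of_nat n powr (- s)) has_field_derivative (Ln (of_nat n) * of_nat n powr (- s)) * (- 1)) (at (s :: complex))"
    using False by (intro DERIV_chain2[OF has_field_derivative_powr_right]) (auto intro!: derivative_eq_intros)
  moreover have "Ln (of_nat n :: complex) = of_real (ln (real n))"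
    using False Ln_of_real[of "real n"] by simp
  ultimately show ?thesis by simp
qed simp

lemma norm_of_nat_powr_diff_le:
  assumes n: "n > 0" and s: "Re s \<ge> -1"
    and x: "x \<in> closed_segment (of_nat n) (of_nat (Suc n))"
  shows "norm (x powr (- s) - of_nat n powr (- s) :: complex) \<le> norm s * real n powr (- Re s - 1)"
proof -
  let ?S = "closed_segment (of_nat n) (of_nat (Suc n)) :: complex set"
  have S: "y \<in> \<real> \<and> Re y \<ge> real n" if "y \<in> ?S" for y
    using that by (auto simp: closed_segment_def algebra_simps scaleR_conv_of_real)
  have "norm (x powr (- s) - of_nat n powr (- s) :: complex) \<le> norm s * real n powr (- Re s - 1) * norm (x - of_nat n)"
  proof (rule field_differentiable_bound[OF convex_closed_segment _ _ x])
    fix y assume y: "y \<in> ?S"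
    have "y \<notin> \<real>\<^sub>\<le>\<^sub>0" using S[OF y] n by (auto simp: complex_nonpos_Reals_iff)
    then show "((\<lambda>y. y powr (- s)) has_field_derivative - s * y powr (- s - 1)) (at y within ?S)"
      by (rule has_field_derivative_at_within[OF has_field_derivative_powr])
    have "norm (- s * y powr (- s - 1)) = norm s * Re y powr (- Re s - 1)"
      using S[OF y] n by (simp add: norm_mult norm_powr_real_powr)
    also have "\<dots> \<le> norm s * real n powr (- Re s - 1)"
      using S[OF y] n s by (intro mult_left_mono powr_mono2') auto
    finally show "norm (- s * y powr (- s - 1)) \<le> norm s * real n powr (- Re s - 1)" .
  qed auto
  also have "norm (x - of_nat n) \<le> 1"
    using segment_bound(1)[OF x] by simp
  finally show ?thesis by (simp add: mult_left_mono)
qed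

text \<open>
  The terms of a series for \<open>(s - 1) * \<zeta> s\<close>: \<open>(s - 1) * n\<^sup>-\<^sup>s\<close> is compared with \<open>(s - 1)\<close> times the integral
  of \<open>x\<^sup>-\<^sup>s\<close> over \<open>[n, n+1]\<close>, and multiplying by \<open>s - 1\<close> beforehand makes every term entire. Since
  \<open>0 powr z = 0\<close>, the term for \<open>n = 0\<close> is the constant 1.
\<close>
definition zeta_reg_term :: "nat \<Rightarrow> complex \<Rightarrow> complex" where
  "zeta_reg_term n s = (s - 1) * of_nat n powr (- s) - of_nat n powr (1 - s) + of_nat (Suc n) powr (1 - s)"

text \<open>
  Comparing a value with the mean over \<open>[n, n+1]\<close> gains one power of \<open>n\<close>, which is why the series for
  \<open>zeta_reg\<close> converges for \<open>Re s > 0\<close> while that of \<open>\<zeta>\<close> needs \<open>Re s > 1\<close>.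
\<close>
lemma norm_zeta_reg_term_le:
  assumes n: "n > 0" and s: "Re s \<ge> -1"
  shows "norm (zeta_reg_term n s) \<le> norm (s - 1) * norm s * real n powr (- Re s - 1)"
proof -
  let ?S = "closed_segment (of_nat n) (of_nat (Suc n)) :: complex set"
  let ?h = "\<lambda>y. y powr (1 - s) + (s - 1) * of_nat n powr (- s) * y"
  have S: "y \<in> \<real> \<and> Re y \<ge> real n" if "y \<in> ?S" for y
    using that by (auto simp: closed_segment_def algebra_simps scaleR_conv_of_real)
  have "norm (?h (of_nat (Suc n)) - ?h (of_nat n)) \<le> norm (s - 1) * norm s * real n powr (- Re s - 1)
      * norm (of_nat (Suc n) - of_nat n :: complex)"
  proof (rule field_differentiable_bound[OF convex_closed_segment])
    fix y assume y: "y \<in> ?S"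
    have "y \<notin> \<real>\<^sub>\<le>\<^sub>0" using S[OF y] n by (auto simp: complex_nonpos_Reals_iff)
    then show "(?h has_field_derivative (1 - s) * (y powr (- s) - of_nat n powr (- s))) (at y within ?S)"
      by (auto intro!: derivative_eq_intros simp: algebra_simps)
    show "norm ((1 - s) * (y powr (- s) - of_nat n powr (- s))) \<le> norm (s - 1) * norm s * real n powr (- Re s - 1)"
      using mult_left_mono[OF norm_of_nat_powr_diff_le[OF n s y], of "norm (s - 1)"]
      by (simp add: norm_mult norm_minus_commute mult_ac)
  qed auto
  then show ?thesis by (simp add: zeta_reg_term_def algebra_simps)
qed

text \<open>
  The function \<open>(s - 1) * \<zeta> s\<close>, which is holomorphic for \<open>Re s > 0\<close> and has no pole to be treated
  separately.
\<close>
definition zeta_reg :: "complex \<Rightarrow> complex" where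
  "zeta_reg s = (\<Sum>n. zeta_reg_term n s)"

lemma zeta_reg_sums_holomorphic:
  shows zeta_reg_sums: "Re s > 0 \<Longrightarrow> (\<lambda>n. zeta_reg_term n s) sums zeta_reg s"
    and holomorphic_zeta_reg: "zeta_reg holomorphic_on {s. Re s > 0}"
proof -
  let ?S = "{s. Re s > 0}"
  define f' where "f' = (\<lambda>n s. deriv (zeta_reg_term n) s)"
  have hol: "zeta_reg_term n holomorphic_on UNIV" for n
    unfolding zeta_reg_term_def by (intro holomorphic_intros)
  have S: "open ?S" by (simp add: open_halfspace_Re_gt)
  have "\<exists>g g'. \<forall>x\<in>?S. ((\<lambda>n. zeta_reg_term n x) sums g x) \<and> ((\<lambda>n. f' n x) sums g' x) \<and> (g has_field_derivative g' x) (at x)"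
  proof (rule series_and_derivative_comparison_complex[OF S])
    fix n s show "(zeta_reg_term n has_field_derivative f' n s) (at s)"
      unfolding f'_def by (rule holomorphic_derivI[OF hol]) auto
  next
    fix x assume x: "x \<in> ?S"
    define d where "d = Re x / 2"
    define M where "M = norm x + d + 1"
    define h where "h = (\<lambda>n. of_real (M * M * real n powr (- d - 1)) :: complex)"
    have d: "d > 0" using x by (simp add: d_def)
    have M: "M > 0" using d by (simp add: M_def add_nonneg_pos)
    have "summable (\<lambda>n. M * M * real n powr (- d - 1))"
      using d by (intro summable_mult) (simp add: summable_real_powr_iff)
    then have "summable h" unfolding h_def by (rule summable_of_real)
    moreover have "range h \<subseteq> \<real>\<^sub>\<ge>\<^sub>0" using M by (auto simp: h_def nonneg_Reals_of_real_iff simp del: of_real_mult)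
    moreover have "\<forall>\<^sub>F n in sequentially. \<forall>y\<in>ball x d \<inter> ?S. norm (zeta_reg_term n y) \<le> norm (h n)"
      using eventually_gt_at_top[of 0]
    proof eventually_elim
      case (elim n)
      show ?case
      proof
        fix y assume y: "y \<in> ball x d \<inter> ?S"
        have "\<bar>Re x - Re y\<bar> < d" using y abs_Re_le_cmod[of "x - y"] by (simp add: dist_norm)
        then have Re: "Re y > d" by (simp add: d_def abs_if field_simps split: if_splits)
        have ny: "norm y \<le> M" using y norm_triangle_ineq2[of y x] by (simp add: M_def dist_norm norm_minus_commute)
        have ny1: "norm (y - 1) \<le> M" using y norm_triangle_ineq2[of y x] norm_triangle_ineq4[of y 1]
          by (simp add: M_def dist_norm norm_minus_commute)
        have "norm (zeta_reg_term n y) \<le> norm (y - 1) * norm y * real n powr (- Re y - 1)"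
          using Re d by (intro norm_zeta_reg_term_le elim) auto
        also have "\<dots> \<le> M * M * real n powr (- d - 1)"
          using ny ny1 M Re elim by (intro mult_mono powr_mono) auto
        also have "\<dots> = norm (h n)" using M by (simp add: h_def norm_mult)
        finally show "norm (zeta_reg_term n y) \<le> norm (h n)" .
      qed
    qed
    ultimately show "\<exists>d h. 0 < d \<and> summable h \<and> range h \<subseteq> \<real>\<^sub>\<ge>\<^sub>0 \<and>
        (\<forall>\<^sub>F n in sequentially. \<forall>y\<in>ball x d \<inter> ?S. norm (zeta_reg_term n y) \<le> norm (h n :: complex))"
      using d by (intro exI[of _ d] exI[of _ h] conjI)
  qed
  then obtain g g' where g: "\<And>x. x \<in> ?S \<Longrightarrow> (\<lambda>n. zeta_reg_term n x) sums g x"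
      "\<And>x. x \<in> ?S \<Longrightarrow> (g has_field_derivative g' x) (at x)" by blast
  have eq: "zeta_reg x = g x" if "x \<in> ?S" for x
    using g(1)[OF that] by (simp add: zeta_reg_def sums_iff)
  show "Re s > 0 \<Longrightarrow> (\<lambda>n. zeta_reg_term n s) sums zeta_reg s"
    using g(1) eq by auto
  have "g holomorphic_on ?S"
    using g(2) S by (auto simp: holomorphic_on_open)
  then show "zeta_reg holomorphic_on ?S"
    by (rule holomorphic_transform) (simp add: eq)
qed

lemma zeta_reg_1: "zeta_reg 1 = 1"
proof -
  have "zeta_reg_term n 1 = (if n = 0 then 1 else 0)" for n
    using of_nat_neq_0[of n, where ?'a = complex] by (simp add: zeta_reg_term_def del: of_nat_Suc)
  then have "zeta_reg 1 = (\<Sum>n. if n = 0 then 1 else 0)" by (simp add: zeta_reg_def)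
  also have "\<dots> = 1" using suminf_finite[of "{0}" "\<lambda>n::nat. if n = 0 then 1 else 0 :: complex"] by simp
  finally show ?thesis .
qed

lemma summable_norm_dirichlet:
  assumes "Re s > 1"
  shows "summable (\<lambda>n. norm (of_nat n powr (- s) :: complex))"
  using assms by (simp add: norm_of_nat_powr summable_real_powr_iff)

lemma summable_ln_dirichlet:
  assumes "x > 1"
  shows "summable (\<lambda>n. ln (real n) * real n powr (- x))"
proof (rule summable_comparison_test_ev)
  define d where "d = (x - 1) / 2"
  have d: "d > 0" using assms by (simp add: d_def)
  show "\<forall>\<^sub>F n in sequentially. norm (ln (real n) * real n powr (- x)) \<le> 1 / d * real n powr (- d - 1)"
    using eventually_gt_at_top[of 0]
  proof eventually_elim
    case (elim n)
    have "ln (real n) \<le> real n powr d / d" using elim d by (intro ln_powr_bound) auto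
    then have "ln (real n) * real n powr (- x) \<le> real n powr d / d * real n powr (- x)"
      by (intro mult_right_mono) auto
    also have "\<dots> = 1 / d * real n powr (- d - 1)"
      using powr_add[of "real n" d "- x"] by (simp add: d_def field_simps)
    finally show ?case using elim by simp
  qed
  show "summable (\<lambda>n. 1 / d * real n powr (- d - 1))"
    using d by (intro summable_mult) (simp add: summable_real_powr_iff)
qed

definition zeta_series :: "complex \<Rightarrow> complex" where
  "zeta_series s = (\<Sum>n. of_nat n powr (- s))"

lemma zeta_series_sums:
  assumes "Re s > 1"
  shows "(\<lambda>n. of_nat n powr (- s)) sums zeta_series s"
  unfolding zeta_series_def by (rule summable_sums[OF summable_norm_cancel[OF summable_norm_dirichlet[OF assms]]])

text \<open>
  The correction terms \<open>n\<^sup>1\<^sup>-\<^sup>s\<close> telescope, and their last one tends to 0 when \<open>Re s > 1\<close>.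
\<close>
lemma zeta_reg_eq:
  assumes s: "Re s > 1"
  shows "zeta_reg s = (s - 1) * zeta_series s"
proof -
  have "(\<lambda>N. \<Sum>n<N. zeta_reg_term n s) = (\<lambda>N. (s - 1) * (\<Sum>n<N. of_nat n powr (- s)) + of_nat N powr (1 - s))"
  proof
    fix N show "(\<Sum>n<N. zeta_reg_term n s) = (s - 1) * (\<Sum>n<N. of_nat n powr (- s)) + of_nat N powr (1 - s)"
      by (induction N) (auto simp: zeta_reg_term_def algebra_simps)
  qed
  moreover have "(\<lambda>N. of_nat N powr (1 - s) :: complex) \<longlonglongrightarrow> 0"
  proof (rule tendsto_norm_zero_cancel)
    show "(\<lambda>N. norm (of_nat N powr (1 - s) :: complex)) \<longlonglongrightarrow> 0"
      unfolding norm_of_nat_powr using s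
      by (intro tendsto_neg_powr filterlim_real_sequentially) auto
  qed
  ultimately have "(\<lambda>N. \<Sum>n<N. zeta_reg_term n s) \<longlonglongrightarrow> (s - 1) * zeta_series s + 0"
    using zeta_series_sums[OF s] by (simp only:) (intro tendsto_intros, auto simp: sums_def)
  then show ?thesis
    using zeta_reg_sums[of s] s LIMSEQ_unique by (auto simp: sums_def)
qed

lemma zeta_series_deriv:
  assumes s: "Re s > 1"
  shows "(\<lambda>n. of_real (ln (real n)) * of_nat n powr (- s)) sums (- deriv zeta_series s)"
    and "(zeta_series has_field_derivative deriv zeta_series s) (at s)"
proof -
  let ?S = "{s. Re s > 1}"
  have S: "open ?S" by (simp add: open_halfspace_Re_gt)
  have "\<exists>g g'. \<forall>x\<in>?S. ((\<lambda>n. of_nat n powr (- x)) sums g x) \<and>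
      ((\<lambda>n. - of_real (ln (real n)) * of_nat n powr (- x)) sums g' x) \<and> (g has_field_derivative g' x) (at x)"
  proof (rule series_and_derivative_comparison_complex[OF S has_field_derivative_of_nat_powr_minus])
    fix x assume x: "x \<in> ?S"
    define d where "d = (Re x - 1) / 2"
    have d: "d > 0" using x by (simp add: d_def)
    have "summable (\<lambda>n. of_real (real n powr (- 1 - d)) :: complex)"
      using d by (intro summable_of_real) (simp add: summable_real_powr_iff)
    moreover have "norm (of_nat n powr (- y) :: complex) \<le> norm (of_real (real n powr (- 1 - d)) :: complex)"
      if "y \<in> ball x d \<inter> ?S" for y n
    proof (cases "n = 0")
      case False
      have "\<bar>Re x - Re y\<bar> < d" using that abs_Re_le_cmod[of "x - y"] by (simp add: dist_norm)
      then have "- Re y \<le> - 1 - d" by (simp add: d_def abs_if field_simps split: if_splits)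
      then show ?thesis using False by (simp add: norm_of_nat_powr powr_mono)
    qed simp
    ultimately show "\<exists>d h. 0 < d \<and> summable h \<and> range h \<subseteq> \<real>\<^sub>\<ge>\<^sub>0 \<and>
        (\<forall>\<^sub>F n in sequentially. \<forall>y\<in>ball x d \<inter> ?S. norm (of_nat n powr (- y) :: complex) \<le> norm (h n :: complex))"
      using d by (intro exI[of _ d] exI[of _ "\<lambda>n. of_real (real n powr (- 1 - d))"])
        (auto simp: nonneg_Reals_of_real_iff)
  qed
  then obtain g g' where g: "\<And>x. x \<in> ?S \<Longrightarrow> (\<lambda>n. of_nat n powr (- x)) sums g x"
      "\<And>x. x \<in> ?S \<Longrightarrow> (\<lambda>n. - of_real (ln (real n)) * of_nat n powr (- x)) sums g' x"
      "\<And>x. x \<in> ?S \<Longrightarrow> (g has_field_derivative g' x) (at x)" by blast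
  have eq: "g x = zeta_series x" if "x \<in> ?S" for x
    using g(1)[OF that] by (simp add: zeta_series_def sums_iff)
  have D: "(zeta_series has_field_derivative g' s) (at s)"
    by (rule has_field_derivative_transform_within_open[OF g(3) S]) (use s eq in auto)
  then show "(zeta_series has_field_derivative deriv zeta_series s) (at s)"
    by (simp add: DERIV_imp_deriv)
  show "(\<lambda>n. of_real (ln (real n)) * of_nat n powr (- s)) sums (- deriv zeta_series s)"
    using sums_minus[OF g(2)[of s]] s DERIV_imp_deriv[OF D] by simp
qed

definition mangoldt_series :: "complex \<Rightarrow> complex" where
  "mangoldt_series s = (\<Sum>n. mangoldt n * of_nat n powr (- s))"

lemma summable_norm_mangoldt:
  assumes "Re s > 1"
  shows "summable (\<lambda>n. norm (mangoldt n * of_nat n powr (- s) :: complex))"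
proof (rule summable_comparison_test[OF _ summable_ln_dirichlet[OF assms]])
  have "norm (norm (mangoldt n * of_nat n powr (- s) :: complex)) \<le> ln (real n) * real n powr (- Re s)" if "n \<ge> 1" for n
  proof -
    have "mangoldt n * real n powr (- Re s) \<le> ln (real n) * real n powr (- Re s)"
      using that by (intro mult_right_mono mangoldt_le) auto
    then show ?thesis unfolding norm_mult norm_mangoldt norm_of_nat_powr by simp
  qed
  then show "\<exists>N. \<forall>n\<ge>N. norm (norm (mangoldt n * of_nat n powr (- s) :: complex)) \<le> ln (real n) * real n powr (- Re s)"
    by blast
qed

lemma mangoldt_series_sums:
  assumes "Re s > 1"
  shows "(\<lambda>n. mangoldt n * of_nat n powr (- s)) sums mangoldt_series s"
  unfolding mangoldt_series_def by (rule summable_sums[OF summable_norm_cancel[OF summable_norm_mangoldt[OF assms]]])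

text \<open>
  The Dirichlet product of \<open>\<Lambda>\<close> and the constant 1 is \<open>ln\<close> (\<open>mangoldt_sum\<close>). The double series is
  absolutely summable, so it may be regrouped by the value \<open>n = d * e\<close> of the product.
\<close>
lemma mangoldt_series_times_zeta_series:
  assumes s: "Re s > 1"
  shows "mangoldt_series s * zeta_series s = - deriv zeta_series s"
proof -
  let ?P = "{1::nat..}"
  have restr: "(f has_sum S) ?P" if "(f has_sum S) UNIV" "f 0 = 0" for f :: "nat \<Rightarrow> complex" and S
  proof -
    have "f x = 0" if "\<not> 1 \<le> x" for x using that \<open>f 0 = 0\<close> by (cases x) auto
    then have "(f has_sum S) UNIV = (f has_sum S) ?P"
      by (intro has_sum_cong_neutral) auto
    then show ?thesis using that(1) by simp
  qed
  have F: "((\<lambda>n. mangoldt n * of_nat n powr (- s)) has_sum mangoldt_series s) ?P"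
    by (rule restr[OF norm_summable_imp_has_sum[OF summable_norm_mangoldt[OF s] mangoldt_series_sums[OF s]]]) simp
  have Z: "((\<lambda>n. of_nat n powr (- s)) has_sum zeta_series s) ?P"
    by (rule restr[OF norm_summable_imp_has_sum[OF summable_norm_dirichlet[OF s] zeta_series_sums[OF s]]]) simp
  have abs: "(\<lambda>n. norm (f n)) summable_on ?P" if "summable (\<lambda>n. norm (f n))" for f :: "nat \<Rightarrow> complex"
  proof (rule summable_on_subset_banach)
    show "(\<lambda>n. norm (f n)) summable_on UNIV"
      using that by (intro norm_summable_imp_summable_on) simp
  qed simp
  let ?f = "\<lambda>(d, e). mangoldt d * of_nat d powr (- s) * of_nat e powr (- s) :: complex"
  have "(\<lambda>x. norm (?f x)) summable_on ?P \<times> ?P"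
  proof (rule summable_on_SigmaI)
    show "((\<lambda>y. norm (?f (x, y))) has_sum norm (mangoldt x * of_nat x powr (- s) :: complex)
        * infsum (\<lambda>n. norm (of_nat n powr (- s) :: complex)) ?P) ?P" for x
      using has_sum_cmult_right[OF has_sum_infsum[OF abs[OF summable_norm_dirichlet[OF s]]],
          of "norm (mangoldt x * of_nat x powr (- s) :: complex)"]
      unfolding prod.case norm_mult[of "mangoldt x * of_nat x powr (- s) :: complex"] .
    show "(\<lambda>x. norm (mangoldt x * of_nat x powr (- s) :: complex)
        * infsum (\<lambda>n. norm (of_nat n powr (- s) :: complex)) ?P) summable_on ?P"
      by (rule summable_on_cmult_left[OF abs[OF summable_norm_mangoldt[OF s]]])
  qed (rule norm_ge_zero)
  then have "?f summable_on ?P \<times> ?P" by (rule abs_summable_summable)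
  then have FZ: "(?f has_sum (mangoldt_series s * zeta_series s)) (?P \<times> ?P)"
  proof (rule has_sum_SigmaI[rotated 2])
    show "((\<lambda>y. ?f (x, y)) has_sum (mangoldt x * of_nat x powr (- s) * zeta_series s)) ?P" for x
      using has_sum_cmult_right[OF Z] by simp
    show "((\<lambda>x. mangoldt x * of_nat x powr (- s) * zeta_series s) has_sum mangoldt_series s * zeta_series s) ?P"
      by (rule has_sum_cmult_left[OF F])
  qed
  have "(?f has_sum (mangoldt_series s * zeta_series s)) (?P \<times> ?P) \<longleftrightarrow>
      ((\<lambda>(n, d). mangoldt d * of_nat n powr (- s)) has_sum (mangoldt_series s * zeta_series s))
        (SIGMA n:?P. {d. d dvd n})"
  proof (rule has_sum_reindex_bij_witness[of _ "\<lambda>(n, d). (d, n div d)" "\<lambda>(d, e). (d * e, d)"])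
    fix x assume "x \<in> ?P \<times> ?P"
    then show "(case (case x of (d, e) \<Rightarrow> (d * e, d)) of (n, d) \<Rightarrow> mangoldt d * of_nat n powr (- s)) = ?f x"
      by (auto simp: powr_times_real)
  next
    fix y assume "y \<in> (SIGMA n:?P. {d. d dvd n})"
    then show "(case y of (n, d) \<Rightarrow> (d, n div d)) \<in> ?P \<times> ?P"
      by (auto elim!: dvdE simp: Suc_le_eq)
  qed (auto simp: Suc_le_eq)
  with FZ have "((\<lambda>(n, d). mangoldt d * of_nat n powr (- s)) has_sum (mangoldt_series s * zeta_series s))
        (SIGMA n:?P. {d. d dvd n})" by simp
  then have "((\<lambda>n. of_real (ln (real n)) * of_nat n powr (- s)) has_sum (mangoldt_series s * zeta_series s)) ?P"
  proof (rule has_sum_SigmaD)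
    fix n assume n: "n \<in> ?P"
    have "((\<lambda>d. mangoldt d * of_nat n powr (- s)) has_sum (\<Sum>d | d dvd n. mangoldt d * of_nat n powr (- s))) {d. d dvd n}"
      using n by (intro has_sum_finite) (auto simp: Suc_le_eq)
    also have "(\<Sum>d | d dvd n. mangoldt d * of_nat n powr (- s)) = of_real (ln (real n)) * of_nat n powr (- s)"
      using n by (simp add: mangoldt_sum flip: sum_distrib_right)
    finally show "((\<lambda>y. case (n, y) of (n, d) \<Rightarrow> mangoldt d * of_nat n powr (- s))
        has_sum of_real (ln (real n)) * of_nat n powr (- s)) {d. d dvd n}" by simp
  qed
  then have "((\<lambda>n. of_real (ln (real n)) * of_nat n powr (- s)) has_sum (mangoldt_series s * zeta_series s)) UNIV"
    by (rule has_sum_cong_neutral[THEN iffD1, rotated -1]) (auto simp: not_le)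
  then show ?thesis
    using has_sum_imp_sums zeta_series_deriv(1)[OF s] sums_unique2 by blast
qed

section \<open>Zeros of the zeta function and analytic continuation\<close>

text \<open>
  The logarithmic derivative has a simple pole at a zero, with the multiplicity of the zero as
  residue. The point \<open>\<eta>\<close> excludes the zero function.
\<close>
lemma log_deriv_limit:
  fixes f :: "complex \<Rightarrow> complex"
  assumes f: "f holomorphic_on S" and S: "open S" "connected S" and \<xi>: "\<xi> \<in> S"
    and nz: "\<eta> \<in> S" "f \<eta> \<noteq> 0"
  obtains m :: nat where "((\<lambda>s. (s - \<xi>) * (deriv f s / f s)) \<longlongrightarrow> of_nat m) (at \<xi>)"
    "\<forall>\<^sub>F s in at \<xi>. f s \<noteq> 0" "f \<xi> = 0 \<longleftrightarrow> m > 0"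
proof (cases "f \<xi> = 0")
  case False
  have c: "isCont f \<xi>" "isCont (deriv f) \<xi>"
    using f holomorphic_deriv[OF f S(1)] S(1) \<xi>
    by (auto simp: continuous_on_eq_continuous_at dest!: holomorphic_on_imp_continuous_on)
  have "((\<lambda>s. (s - \<xi>) * (deriv f s / f s)) \<longlongrightarrow> (\<xi> - \<xi>) * (deriv f \<xi> / f \<xi>)) (at \<xi>)"
    using c False by (intro tendsto_intros) (auto simp: isCont_def)
  moreover have "\<forall>\<^sub>F s in at \<xi>. f s \<noteq> 0"
    using c(1) False by (intro tendsto_imp_eventually_ne[of f "f \<xi>"]) (auto simp: isCont_def)
  ultimately show ?thesis using that[of 0] False by simp
next
  case True
  then have "\<not> f constant_on S" using nz \<xi> unfolding constant_on_def by metis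
  then obtain g r n where g: "0 < n" "0 < r" "ball \<xi> r \<subseteq> S" "g holomorphic_on ball \<xi> r"
      "\<And>w. w \<in> ball \<xi> r \<Longrightarrow> f w = (w - \<xi>)^n * g w" "\<And>w. w \<in> ball \<xi> r \<Longrightarrow> g w \<noteq> 0"
    using holomorphic_factor_zero_nonconstant[OF f S \<xi> True] by metis
  have c: "isCont g \<xi>" "isCont (deriv g) \<xi>"
    using g(2,4) holomorphic_deriv[OF g(4) open_ball]
    by (auto simp: continuous_on_eq_continuous_at dest!: holomorphic_on_imp_continuous_on)
  have near: "\<forall>\<^sub>F s in at \<xi>. s \<in> ball \<xi> r - {\<xi>}"
    using g(2) by (intro eventually_at_in_open) auto
  have "((\<lambda>s. of_nat n + (s - \<xi>) * (deriv g s / g s)) \<longlongrightarrow> of_nat n + (\<xi> - \<xi>) * (deriv g \<xi> / g \<xi>)) (at \<xi>)"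
    using c g(2,6) by (intro tendsto_intros) (auto simp: isCont_def)
  moreover have "\<forall>\<^sub>F s in at \<xi>. of_nat n + (s - \<xi>) * (deriv g s / g s) = (s - \<xi>) * (deriv f s / f s)"
    using near
  proof eventually_elim
    case (elim s)
    have "((\<lambda>w. (w - \<xi>)^n * g w) has_field_derivative
        of_nat n * (s - \<xi>)^(n - 1) * g s + (s - \<xi>)^n * deriv g s) (at s)"
      using elim by (auto intro!: derivative_eq_intros holomorphic_derivI[OF g(4) open_ball])
    then have "(f has_field_derivative of_nat n * (s - \<xi>)^(n - 1) * g s + (s - \<xi>)^n * deriv g s) (at s)"
      by (rule has_field_derivative_transform_within_open[OF _ open_ball]) (use elim g(5) in auto)
    then have d: "deriv f s = of_nat n * (s - \<xi>)^(n - 1) * g s + (s - \<xi>)^n * deriv g s"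
      by (rule DERIV_imp_deriv)
    have "(s - \<xi>) * deriv f s = (s - \<xi>)^n * (of_nat n * g s + (s - \<xi>) * deriv g s)"
      unfolding d using g(1) by (cases n) (auto simp: algebra_simps)
    then have "(s - \<xi>) * (deriv f s / f s) = (s - \<xi>)^n * (of_nat n * g s + (s - \<xi>) * deriv g s) / ((s - \<xi>)^n * g s)"
      using elim g(5)[of s] by simp
    also have "\<dots> = of_nat n + (s - \<xi>) * (deriv g s / g s)"
      using elim g(6)[of s] by (simp add: add_divide_distrib)
    finally show ?case by simp
  qed
  ultimately have "((\<lambda>s. (s - \<xi>) * (deriv f s / f s)) \<longlongrightarrow> of_nat n) (at \<xi>)"
    by (auto dest: Lim_transform_eventually)
  moreover have "\<forall>\<^sub>F s in at \<xi>. f s \<noteq> 0"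
    using near by eventually_elim (use g in auto)
  ultimately show ?thesis using that[of n] True g(1) by simp
qed

lemma mangoldt_series_eq:
  assumes s: "Re s > 1" and nz: "zeta_reg s \<noteq> 0"
  shows "mangoldt_series s = 1 / (s - 1) - deriv zeta_reg s / zeta_reg s"
proof -
  have s1: "s \<noteq> 1" using s by auto
  have "((\<lambda>s. (s - 1) * zeta_series s) has_field_derivative zeta_series s + (s - 1) * deriv zeta_series s) (at s)"
    by (auto intro!: derivative_eq_intros zeta_series_deriv(2)[OF s])
  then have "(zeta_reg has_field_derivative zeta_series s + (s - 1) * deriv zeta_series s) (at s)"
    by (rule has_field_derivative_transform_within_open[where S = "{s. Re s > 1}"])
       (use s in \<open>auto simp: zeta_reg_eq open_halfspace_Re_gt\<close>)
  then have "deriv zeta_reg s = zeta_series s + (s - 1) * deriv zeta_series s"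
    by (rule DERIV_imp_deriv)
  also have "deriv zeta_series s = - (mangoldt_series s * zeta_series s)"
    by (simp add: mangoldt_series_times_zeta_series[OF s])
  finally have D: "deriv zeta_reg s = zeta_series s * (1 - (s - 1) * mangoldt_series s)"
    by (simp add: algebra_simps)
  have "deriv zeta_reg s / zeta_reg s = 1 / (s - 1) - mangoldt_series s"
    using nz s1 unfolding D zeta_reg_eq[OF s] by (simp add: field_simps)
  then show ?thesis by simp
qed

text \<open>
  Approaching \<open>z\<close> from the right inside the half plane of convergence, the Dirichlet series of \<open>\<Lambda>\<close> sees
  the pole of \<open>\<zeta>\<close> at 1 as residue 1 and a zero of \<open>\<zeta>\<close> as minus its multiplicity. The two cases
  exclude each other because \<open>zeta_reg 1 = 1\<close>.
\<close>
lemma mangoldt_series_residue: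
  assumes z: "Re z \<ge> 1"
  obtains m :: nat where
    "((\<lambda>x. of_real x * mangoldt_series (z + of_real x)) \<longlongrightarrow> (if z = 1 then 1 else - of_nat m)) (at_right 0)"
    "zeta_reg z = 0 \<longleftrightarrow> m > 0"
proof -
  have "open {s. Re s > 0}" "connected {s. Re s > 0}"
    by (auto simp: open_halfspace_Re_gt intro!: convex_connected convex_halfspace_Re_gt)
  from log_deriv_limit[OF holomorphic_zeta_reg this, of z 1] z zeta_reg_1
  obtain m :: nat where m: "((\<lambda>s. (s - z) * (deriv zeta_reg s / zeta_reg s)) \<longlongrightarrow> of_nat m) (at z)"
    "\<forall>\<^sub>F s in at z. zeta_reg s \<noteq> 0" "zeta_reg z = 0 \<longleftrightarrow> m > 0" by auto
  have lim: "filterlim (\<lambda>x. z + of_real x) (at z) (at_right 0)"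
    by (rule filterlim_atI) (auto intro!: tendsto_eq_intros simp: eventually_at_right_less eventually_at intro: exI[of _ 1])
  have t: "((\<lambda>x. of_real x * (1 / (z + of_real x - 1))) \<longlongrightarrow> (if z = 1 then 1 else 0)) (at_right 0)"
  proof (cases "z = 1")
    case True
    then show ?thesis
      by (auto intro!: tendsto_eventually eventually_at_rightI[of 0 1])
  next
    case False
    have "((\<lambda>x. of_real x * (1 / (z + of_real x - 1))) \<longlongrightarrow> of_real 0 * (1 / (z + of_real 0 - 1))) (at_right 0)"
      using False by (intro tendsto_intros) auto
    then show ?thesis using False by simp
  qed
  have "((\<lambda>x. of_real x * (1 / (z + of_real x - 1)) - ((z + of_real x) - z) * (deriv zeta_reg (z + of_real x) / zeta_reg (z + of_real x)))
      \<longlongrightarrow> (if z = 1 then 1 else 0) - of_nat m) (at_right 0)"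
    by (intro tendsto_diff t filterlim_compose[OF m(1) lim])
  moreover have "\<forall>\<^sub>F x in at_right 0. of_real x * (1 / (z + of_real x - 1)) - ((z + of_real x) - z) * (deriv zeta_reg (z + of_real x) / zeta_reg (z + of_real x))
      = of_real x * mangoldt_series (z + of_real x)"
    using filterlim_iff[THEN iffD1, OF lim, rule_format, OF m(2)] eventually_at_right_less[of "0::real"]
  proof eventually_elim
    case (elim x)
    then have "Re (z + of_real x) > 1" using z by simp
    show ?case unfolding mangoldt_series_eq[OF \<open>Re (z + of_real x) > 1\<close> elim(1)] by (simp add: right_diff_distrib)
  qed
  ultimately have "((\<lambda>x. of_real x * mangoldt_series (z + of_real x)) \<longlongrightarrow> (if z = 1 then 1 else 0) - of_nat m) (at_right 0)"
    by (rule Lim_transform_eventually)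
  moreover have "m = 0" if "z = 1" using m(3) that zeta_reg_1 by simp
  ultimately show ?thesis using that[of m] m(3) by (cases "z = 1") auto
qed

lemma Re_of_nat_powr:
  "n > 0 \<Longrightarrow> Re (of_nat n powr (- s)) = real n powr (- Re s) * cos (Im s * ln (real n))"
  using Ln_of_real[of "real n"] by (simp add: powr_def Re_exp)

text \<open>
  Termwise nonnegativity: \<open>3 + 4 * cos \<phi> + cos (2 * \<phi>) = 2 * (1 + cos \<phi>)\<^sup>2\<close>.
\<close>
lemma mangoldt_series_3_4_1:
  assumes \<sigma>: "\<sigma> > 1"
  shows "3 * Re (mangoldt_series (of_real \<sigma>)) + 4 * Re (mangoldt_series (Complex \<sigma> t))
    + Re (mangoldt_series (Complex \<sigma> (2 * t))) \<ge> 0"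
proof -
  let ?S = "\<lambda>t n. Re (mangoldt n * of_nat n powr (- Complex \<sigma> t))"
  have S: "?S t sums Re (mangoldt_series (Complex \<sigma> t))" for t
    using \<sigma> by (intro sums_Re mangoldt_series_sums) simp
  have sums: "(\<lambda>n. 3 * ?S 0 n + 4 * ?S t n + ?S (2 * t) n) sums
     (3 * Re (mangoldt_series (Complex \<sigma> 0)) + 4 * Re (mangoldt_series (Complex \<sigma> t)) + Re (mangoldt_series (Complex \<sigma> (2 * t))))"
    by (intro sums_add sums_mult S)
  have nonneg: "3 * ?S 0 n + 4 * ?S t n + ?S (2 * t) n \<ge> 0" for n
  proof (cases "n = 0")
    case False
    define c where "c = cos (t * ln (real n))"
    have c2: "cos (2 * t * ln (real n)) = 2 * c^2 - 1"
      using cos_double_cos[of "t * ln (real n)"] by (simp add: c_def mult_ac)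
    define p where "p = mangoldt n * real n powr (- \<sigma>)"
    have "?S u n = p * cos (u * ln (real n))" for u
      using False by (simp add: Re_of_nat_powr p_def)
    then have "3 * ?S 0 n + 4 * ?S t n + ?S (2 * t) n = 3 * p + 4 * (p * c) + p * (2 * c^2 - 1)"
      by (simp only: c2 c_def) simp
    also have "\<dots> = 2 * (p * (1 + c)^2)"
      by (simp add: algebra_simps power2_eq_square)
    finally have "3 * ?S 0 n + 4 * ?S t n + ?S (2 * t) n = 2 * (mangoldt n * real n powr (- \<sigma>) * (1 + c)^2)"
      by (simp only: p_def)
    then show ?thesis by (simp add: mangoldt_nonneg)
  qed simp
  have "0 \<le> 3 * Re (mangoldt_series (Complex \<sigma> 0)) + 4 * Re (mangoldt_series (Complex \<sigma> t))
      + Re (mangoldt_series (Complex \<sigma> (2 * t)))"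
    by (rule sums_le[OF nonneg sums_zero sums])
  then show ?thesis by (simp add: complex_of_real_def)
qed

text \<open>
  On the line \<open>Re z = 1\<close>, a zero of multiplicity \<open>m\<close> at \<open>1 + \<i> * t\<close> and one of multiplicity \<open>m2 \<ge> 0\<close> at
  \<open>1 + 2 * \<i> * t\<close> would turn \<open>mangoldt_series_3_4_1\<close> into \<open>3 - 4 * m - m2 \<ge> 0\<close>, so \<open>m = 0\<close>. For
  \<open>Re z > 1\<close> a zero would be a pole of the Dirichlet series of \<open>\<Lambda>\<close>, which is bounded for
  \<open>Re s \<ge> Re z\<close>.
\<close>
lemma zeta_reg_nonzero:
  assumes z: "Re z \<ge> 1"
  shows "zeta_reg z \<noteq> 0"
proof
  assume zero: "zeta_reg z = 0"
  then have z1: "z \<noteq> 1" using zeta_reg_1 by auto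
  obtain m :: nat where m: "((\<lambda>x. of_real x * mangoldt_series (z + of_real x)) \<longlongrightarrow> - of_nat m) (at_right 0)" "m > 0"
    using mangoldt_series_residue[OF z] zero z1 by auto
  show False
  proof (cases "Re z = 1")
    case True
    define t where "t = Im z"
    have t: "z = Complex 1 t" "t \<noteq> 0" using True z1 by (auto simp: t_def complex_eq_iff)
    obtain m1 :: nat where m1: "((\<lambda>x. of_real x * mangoldt_series (1 + of_real x)) \<longlongrightarrow> 1) (at_right 0)"
      using mangoldt_series_residue[of 1] by auto
    obtain m2 :: nat where m2: "((\<lambda>x. of_real x * mangoldt_series (Complex 1 (2 * t) + of_real x)) \<longlongrightarrow> - of_nat m2) (at_right 0)"
      using mangoldt_series_residue[of "Complex 1 (2 * t)"] t by (auto simp: complex_eq_iff)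
    have "((\<lambda>x. 3 * Re (of_real x * mangoldt_series (1 + of_real x)) + 4 * Re (of_real x * mangoldt_series (z + of_real x))
         + Re (of_real x * mangoldt_series (Complex 1 (2 * t) + of_real x))) \<longlongrightarrow> 3 * Re 1 + 4 * Re (- of_nat m) + Re (- of_nat m2)) (at_right 0)"
      by (intro tendsto_intros m(1) m1 m2)
    moreover have "\<forall>\<^sub>F x in at_right 0. 3 * Re (of_real x * mangoldt_series (1 + of_real x)) + 4 * Re (of_real x * mangoldt_series (z + of_real x))
         + Re (of_real x * mangoldt_series (Complex 1 (2 * t) + of_real x)) \<ge> 0"
      using eventually_at_right_less[of "0::real"]
    proof eventually_elim
      case (elim x)
      have "x * (3 * Re (mangoldt_series (of_real (1 + x))) + 4 * Re (mangoldt_series (Complex (1 + x) t))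
        + Re (mangoldt_series (Complex (1 + x) (2 * t)))) \<ge> 0"
        using elim by (intro mult_nonneg_nonneg mangoldt_series_3_4_1) auto
      moreover have "Complex 1 u + of_real x = Complex (1 + x) u" for u
        by (simp add: complex_eq_iff)
      ultimately show ?case by (simp add: t(1) algebra_simps)
    qed
    ultimately have "3 * Re 1 + 4 * Re (- of_nat m) + Re (- of_nat m2) \<ge> 0"
      by (rule tendsto_lowerbound) simp
    then show False using m(2) by simp
  next
    case False
    then have z: "Re z > 1" using assms by simp
    define M where "M = (\<Sum>n. norm (mangoldt n * of_nat n powr (- z) :: complex))"
    have "((\<lambda>x. of_real x * mangoldt_series (z + of_real x)) \<longlongrightarrow> 0) (at_right 0)"
    proof (rule Lim_null_comparison)
      show "\<forall>\<^sub>F x in at_right 0. norm (of_real x * mangoldt_series (z + of_real x)) \<le> x * M"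
        using eventually_at_right_less[of "0::real"]
      proof eventually_elim
        case (elim x)
        have R: "Re (z + of_real x) > 1" using z elim by simp
        have "norm (mangoldt_series (z + of_real x)) \<le> (\<Sum>n. norm (mangoldt n * of_nat n powr (- (z + of_real x)) :: complex))"
          unfolding mangoldt_series_def by (rule summable_norm[OF summable_norm_mangoldt[OF R]])
        also have "\<dots> \<le> M" unfolding M_def
        proof (rule suminf_le[OF _ summable_norm_mangoldt[OF R] summable_norm_mangoldt[OF z]])
          fix n show "norm (mangoldt n * of_nat n powr (- (z + of_real x)) :: complex) \<le> norm (mangoldt n * of_nat n powr (- z) :: complex)"
          proof (cases "n = 0")
            case False
            then show ?thesis unfolding norm_mult norm_mangoldt norm_of_nat_powr
              using elim by (intro mult_left_mono powr_mono mangoldt_nonneg) auto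
          qed simp
        qed
        finally show ?case using elim by (simp add: norm_mult)
      qed
      show "((\<lambda>x. x * M) \<longlongrightarrow> 0) (at_right 0)" by (auto intro!: tendsto_eq_intros)
    qed
    from tendsto_unique[OF _ this m(1)] m(2) show False by simp
  qed
qed

text \<open>
  Both \<open>- \<zeta>'/\<zeta>\<close> and \<open>\<zeta>\<close> have a simple pole with residue 1 at 1. In terms of \<open>zeta_reg\<close> the poles are
  \<open>1 / (s - 1)\<close> twice, and what remains of \<open>\<zeta>\<close> is a removable difference quotient.
\<close>
lemma mangoldt_minus_one_series_extension:
  obtains U g where "open U" "{s. Re s \<ge> 1} \<subseteq> U" "U \<subseteq> {s. Re s > 0}" "g holomorphic_on U"
    "\<And>s. Re s > 1 \<Longrightarrow> g s = mangoldt_series s - zeta_series s"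
proof
  let ?H = "{s. Re s > 0}"
  let ?U = "?H \<inter> zeta_reg -` (- {0})"
  let ?q = "\<lambda>s. if s = 1 then deriv zeta_reg 1 else (zeta_reg s - zeta_reg 1) / (s - 1)"
  let ?g = "\<lambda>s. - (deriv zeta_reg s / zeta_reg s) - ?q s"
  have H: "open ?H" by (simp add: open_halfspace_Re_gt)
  show U: "open ?U"
    by (rule continuous_open_preimage[OF holomorphic_on_imp_continuous_on[OF holomorphic_zeta_reg] H]) auto
  show "{s. Re s \<ge> 1} \<subseteq> ?U" "?U \<subseteq> ?H" using zeta_reg_nonzero by auto
  have "?q holomorphic_on ?U" "deriv zeta_reg holomorphic_on ?U" "zeta_reg holomorphic_on ?U"
    using holomorphic_on_subset[OF pole_lemma_open[OF holomorphic_zeta_reg H, of 1], of ?U]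
      holomorphic_on_subset[OF holomorphic_deriv[OF holomorphic_zeta_reg H], of ?U]
      holomorphic_on_subset[OF holomorphic_zeta_reg, of ?U] by auto
  then show "?g holomorphic_on ?U"
    by (intro holomorphic_on_diff holomorphic_on_minus holomorphic_on_divide) auto
  fix s assume s: "Re s > 1"
  then have s1: "s \<noteq> 1" by auto
  show "?g s = mangoldt_series s - zeta_series s"
  proof -
    have "?q s = zeta_series s - 1 / (s - 1)"
      using s1 by (simp add: zeta_reg_1 zeta_reg_eq[OF s] diff_divide_distrib)
    then show ?thesis
      using mangoldt_series_eq[OF s zeta_reg_nonzero] s by simp
  qed
qed

section \<open>Chebyshev's bound and a Tauberian criterion for monotone functions\<close>

definition psi :: "nat \<Rightarrow> real" where
  "psi n = (\<Sum>k=1..n. mangoldt k)"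

lemma mono_psi: "m \<le> n \<Longrightarrow> psi m \<le> psi n"
  unfolding psi_def by (intro sum_mono2) (auto simp: mangoldt_nonneg)

lemma card_multiples: "d > 0 \<Longrightarrow> card {k \<in> {1..n}. d dvd k} = n div d"
proof -
  assume d: "d > 0"
  have "{k \<in> {1..n}. d dvd k} = (\<lambda>j. d * j) ` {1..n div d}"
  proof (intro set_eqI iffI)
    fix k assume "k \<in> {k \<in> {1..n}. d dvd k}"
    then obtain j where j: "k = d * j" "1 \<le> k" "k \<le> n" by auto
    then have "j \<in> {1..n div d}" using d by (auto simp: less_eq_div_iff_mult_less_eq mult.commute Suc_le_eq)
    then show "k \<in> (\<lambda>j. d * j) ` {1..n div d}" using j by auto
  next
    fix k assume "k \<in> (\<lambda>j. d * j) ` {1..n div d}"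
    then show "k \<in> {k \<in> {1..n}. d dvd k}"
      using d by (auto simp: less_eq_div_iff_mult_less_eq mult.commute Suc_le_eq)
  qed
  moreover have "inj_on (\<lambda>j. d * j) {1..n div d}" using d by (auto simp: inj_on_def)
  ultimately show ?thesis by (simp add: card_image)
qed

text \<open>
  Sum \<open>ln k = \<Sum>d dvd k. \<Lambda> d\<close> over \<open>k \<le> n\<close> and count the multiples of \<open>d\<close>. The upper limit \<open>N\<close> is free
  so that the formulas for \<open>n\<close> and \<open>2 * n\<close> can be subtracted termwise.
\<close>
lemma ln_fact_eq_sum_mangoldt:
  assumes "n \<le> N"
  shows "ln (fact n) = (\<Sum>d=1..N. mangoldt d * real (n div d))"
proof -
  have "ln (fact n) = (\<Sum>k=1..n. ln (real k))"
    unfolding fact_prod of_nat_prod by (subst ln_prod) auto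
  also have "\<dots> = (\<Sum>k=1..n. \<Sum>d | d \<in> {1..N} \<and> d dvd k. mangoldt d)"
  proof (intro sum.cong refl)
    fix k assume k: "k \<in> {1..n}"
    then have "{d. d \<in> {1..N} \<and> d dvd k} = {d. d dvd k}"
      using assms by (auto simp: Suc_le_eq intro: Nat.gr0I dest: dvd_imp_le)
    then show "ln (real k) = (\<Sum>d | d \<in> {1..N} \<and> d dvd k. mangoldt d)"
      using mangoldt_sum[of k, where ?'a = real] k by simp
  qed
  also have "\<dots> = (\<Sum>d=1..N. \<Sum>k | k \<in> {1..n} \<and> d dvd k. mangoldt d)"
    by (rule sum.swap_restrict) auto
  also have "\<dots> = (\<Sum>d=1..N. mangoldt d * real (n div d))"
    by (intro sum.cong refl) (simp add: card_multiples[simplified])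
  finally show ?thesis .
qed

text \<open>
  Chebyshev's argument: \<open>ln (2 * n choose n) = \<Sum>d. \<Lambda> d * (\<lfloor>2 * n / d\<rfloor> - 2 * \<lfloor>n / d\<rfloor>)\<close>, where no coefficient
  is negative and the one of each \<open>d\<close> in \<open>(n, 2 * n]\<close> is 1.
\<close>
lemma psi_double_le: "psi (2 * n) - psi n \<le> 2 * real n * ln 2"
proof -
  have "psi (2 * n) - psi n = (\<Sum>d=n+1..2*n. mangoldt d)"
  proof -
    have "{1..2*n} = {1..n} \<union> {n+1..2*n}" by auto
    then show ?thesis unfolding psi_def by (simp add: sum.union_disjoint)
  qed
  also have "\<dots> = (\<Sum>d=n+1..2*n. mangoldt d * (real (2 * n div d) - 2 * real (n div d)))"
  proof (intro sum.cong refl)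
    fix d assume d: "d \<in> {n+1..2*n}"
    then have "2 * n div d = 1" "n div d = 0" by (auto intro!: div_nat_eqI)
    then show "mangoldt d = mangoldt d * (real (2 * n div d) - 2 * real (n div d))" by simp
  qed
  also have "\<dots> \<le> (\<Sum>d=1..2*n. mangoldt d * (real (2 * n div d) - 2 * real (n div d)))"
  proof (intro sum_mono2)
    fix d
    have "2 * (n div d) \<le> 2 * n div d"
      by (cases "d = 0") (auto simp: less_eq_div_iff_mult_less_eq div_times_less_eq_dividend)
    then show "0 \<le> mangoldt d * (real (2 * n div d) - 2 * real (n div d))"
      by (intro mult_nonneg_nonneg mangoldt_nonneg) linarith
  qed auto
  also have "\<dots> = ln (fact (2 * n)) - 2 * ln (fact n)"
    by (simp add: ln_fact_eq_sum_mangoldt[of _ "2 * n"] sum_subtractf algebra_simps sum_distrib_left)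
  also have "\<dots> = ln (real (2 * n choose n))"
  proof -
    have "real (2 * n choose n) = fact (2 * n) / (fact n * fact n)"
      using binomial_fact[of n "2 * n", where ?'a = real] by simp
    then show ?thesis by (simp only:) (simp add: ln_div ln_mult)
  qed
  also have "\<dots> \<le> ln (2 ^ (2 * n))"
  proof (rule ln_mono)
    have "real (2 * n choose n) \<le> real (2 ^ (2 * n))"
      by (rule of_nat_mono[OF binomial_le_pow2])
    then show "real (2 * n choose n) \<le> 2 ^ (2 * n)" by simp
  qed simp_all
  also have "\<dots> = 2 * real n * ln 2" by (subst ln_realpow) simp_all
  finally show ?thesis .
qed

lemma psi_le: "psi n \<le> 4 * real n"
proof (induction n rule: less_induct)
  case (less n)
  show ?case
  proof (cases "n \<le> 1")
    case True
    then have "n = 0 \<or> n = 1" by auto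
    then show ?thesis by (auto simp: psi_def)
  next
    case False
    \<comment> \<open>Rounding up costs at most a factor 2, which the constant 4 in place of \<open>2 * ln 2\<close> absorbs.\<close>
    define m where "m = (n + 1) div 2"
    have m: "m < n" "n \<le> 2 * m" "3 * m \<le> 2 * n" using False by (auto simp: m_def)
    have "psi n \<le> psi (2 * m)" using m by (intro mono_psi)
    also have "\<dots> \<le> psi m + 2 * real m * ln 2" using psi_double_le[of m] by simp
    also have "\<dots> \<le> 4 * real m + 2 * real m * 1"
      using less[OF m(1)] ln_2_less_1 by (intro add_mono mult_left_mono) auto
    also have "\<dots> \<le> 4 * real n" using m(3) by linarith
    finally show ?thesis .
  qed
qed

text \<open>
  If \<open>A n \<ge> (1 + 2 * d) * n\<close>, then monotonicity keeps \<open>A k - k \<ge> d * n\<close> for all \<open>k\<close> in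
  \<open>[n, (1 + d) * n]\<close>, and this block contributes at least a constant multiple of \<open>d\<^sup>2\<close> to the series.
  Cauchy's criterion rules this out for large \<open>n\<close>. If \<open>A n \<le> (1 - 2 * d) * n\<close>, the block to the left of
  \<open>n\<close> does the same with the opposite sign.
\<close>
lemma asymp_of_summable_deviation:
  fixes A :: "nat \<Rightarrow> real"
  assumes mono: "\<And>m n. m \<le> n \<Longrightarrow> A m \<le> A n"
    and summ: "summable (\<lambda>k. (A k - real k) / (real k * (real k + 1)))"
  shows "(\<lambda>n. A n / real n) \<longlonglongrightarrow> 1"
proof -
  let ?t = "\<lambda>k. (A k - real k) / (real k * (real k + 1))"
  have key: "\<forall>\<^sub>F n in sequentially. \<bar>A n / real n - 1\<bar> < 2 * d" if d: "0 < d" "d \<le> 1 / 2" for d :: real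
  proof -
    have "d^2 / 8 > 0" using d by simp
    then obtain N where N: "\<And>m n. m \<ge> N \<Longrightarrow> \<bar>sum ?t {m..<n}\<bar> < d^2 / 8"
      using summ unfolding summable_Cauchy real_norm_def by blast
    show ?thesis
      using eventually_ge_at_top[of "2 * N + 1"]
    proof eventually_elim
      case (elim n)
      then have n: "real n \<ge> 1" "n > 0" "n \<ge> N" by auto
      \<comment> \<open>The block on which \<open>A k - k\<close> stays large has \<open>j + 1 \<ge> d * n\<close> elements.\<close>
      define j where "j = nat \<lfloor>d * real n\<rfloor>"
      have "\<lfloor>d * real n\<rfloor> \<ge> 0" using d by simp
      then have j: "real j \<le> d * real n" "real j + 1 \<ge> d * real n"
        unfolding j_def using of_int_floor_le[of "d * real n"] real_of_int_floor_add_one_ge[of "d * real n"]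
        by (auto simp: of_nat_nat)
      have dn: "d * real n \<le> real n / 2" using d n by (simp add: field_simps)
      have "A n < (1 + 2 * d) * real n"
      proof (rule ccontr)
        assume "\<not> ?thesis"
        then have big: "A n \<ge> (1 + 2 * d) * real n" by simp
        have "d^2 / 8 \<le> d * real n * (d / (6 * real n))" using n d by (simp add: field_simps power2_eq_square)
        also have "\<dots> \<le> (real j + 1) * (d / (6 * real n))"
          using j(2) d n by (intro mult_right_mono) auto
        also have "\<dots> = (\<Sum>k\<in>{n..<n + j + 1}. d / (6 * real n))" by simp
        also have "\<dots> \<le> sum ?t {n..<n + j + 1}"
        proof (intro sum_mono)
          fix k assume "k \<in> {n..<n + j + 1}"
          then have k: "n \<le> k" "real k \<le> real n + real j" by auto
          have k2: "real k \<le> 3 / 2 * real n" using k j dn by linarith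
          have "d * real n \<le> A k - real k"
            using mono[OF k(1)] big k(2) j(1) by (simp add: algebra_simps)
          moreover have "real k * (real k + 1) \<le> (3/2 * real n) * (4 * real n)"
            using k2 n by (intro mult_mono) auto
          moreover have "real k * (real k + 1) > 0" using k n by auto
          moreover have "0 \<le> d * real n" using d by simp
          ultimately have "(d * real n) / ((3/2 * real n) * (4 * real n)) \<le> ?t k"
            by (intro frac_le) linarith+
          moreover have "(d * real n) / ((3/2 * real n) * (4 * real n)) = d / (6 * real n)"
            using n by (simp add: field_simps)
          ultimately show "d / (6 * real n) \<le> ?t k" by simp
        qed
        finally show False using N[OF n(3), of "n + j + 1"] by linarith
      qed
      moreover have "A n > (1 - 2 * d) * real n"
      proof (rule ccontr)
        assume "\<not> ?thesis"
        then have small: "A n \<le> (1 - 2 * d) * real n" by simp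
        have jn: "real j \<le> real n / 2" using j(1) dn by linarith
        then have jn': "2 * j \<le> n" by linarith
        then have mN: "n - j \<ge> N" using elim by linarith
        have "d^2 / 8 \<le> d * real n * (d / (2 * real n))" using n d by (simp add: field_simps power2_eq_square)
        also have "\<dots> \<le> (real j + 1) * (d / (2 * real n))"
          using j(2) d n by (intro mult_right_mono) auto
        also have "\<dots> = (\<Sum>k\<in>{n - j..<n + 1}. d / (2 * real n))" using jn' by (simp add: of_nat_diff)
        also have "\<dots> \<le> (\<Sum>k\<in>{n - j..<n + 1}. - ?t k)"
        proof (intro sum_mono)
          fix k assume "k \<in> {n - j..<n + 1}"
          then have k: "k \<le> n" "real k \<ge> real n - real j" using jn' by (auto simp: of_nat_diff)
          have k0: "real k > 0" using k jn n by linarith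
          have "d * real n \<le> real k - A k"
            using mono[OF k(1)] small k(2) j(1) by (simp add: algebra_simps)
          moreover have "real k * (real k + 1) \<le> real n * (2 * real n)"
            using k n by (intro mult_mono) auto
          moreover have "real k * (real k + 1) > 0" using k0 by auto
          moreover have "0 \<le> d * real n" using d by simp
          ultimately have "(d * real n) / (real n * (2 * real n)) \<le> (real k - A k) / (real k * (real k + 1))"
            by (intro frac_le) linarith+
          also have "\<dots> = - ?t k" by (subst minus_divide_left) simp
          finally have "(d * real n) / (real n * (2 * real n)) \<le> - ?t k" .
          moreover have "(d * real n) / (real n * (2 * real n)) = d / (2 * real n)"
            using n by (simp add: field_simps)
          ultimately show "d / (2 * real n) \<le> - ?t k" by simp
        qed
        also have "\<dots> = - sum ?t {n - j..<n + 1}" by (rule sum_negf)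
        finally show False using N[OF mN, of "n + 1"] by linarith
      qed
      ultimately show ?case using n by (simp add: abs_less_iff field_simps)
    qed
  qed
  show ?thesis
    unfolding tendsto_iff
  proof (intro allI impI)
    fix e :: real assume e: "e > 0"
    show "\<forall>\<^sub>F n in sequentially. dist (A n / real n) 1 < e"
    proof (rule eventually_mono[OF key[of "min (e / 2) (1 / 2)"]])
      fix n assume "\<bar>A n / real n - 1\<bar> < 2 * min (e / 2) (1 / 2)"
      then show "dist (A n / real n) 1 < e" unfolding dist_real_def by linarith
    qed (use e in auto)
  qed
qed

section \<open>The asymptotics of psi\<close>

text \<open>
  The integral of \<open>x powr (- z - 2)\<close> over \<open>[k, k+1]\<close>, an entire function of \<open>z\<close>; the value at \<open>- 1\<close> fills
  the removable singularity of the closed form. The shift \<open>s = 1 + z\<close> puts the boundary line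
  \<open>Re s = 1\<close> on the imaginary axis.
\<close>
definition newman_weight :: "nat \<Rightarrow> complex \<Rightarrow> complex" where
  "newman_weight k z = (if z = -1 then of_real (ln (real (Suc k)) - ln (real k))
     else (of_nat k powr (- (1 + z)) - of_nat (Suc k) powr (- (1 + z))) / (1 + z))"

lemma holomorphic_newman_weight:
  assumes k: "k > 0"
  shows "newman_weight k holomorphic_on UNIV"
proof -
  let ?\<phi> = "\<lambda>z. of_nat k powr (- (1 + z)) - of_nat (Suc k) powr (- (1 + z)) :: complex"
  have d: "((\<lambda>z. of_nat n powr (- (1 + z))) has_field_derivative - of_real (ln (real n)) * of_nat n powr (- (1 + z))) (at (z :: complex))"
    for n z
  proof -
    have "((\<lambda>z. 1 + z) has_field_derivative 1) (at z)" by (auto intro!: derivative_eq_intros)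
    from DERIV_chain2[OF has_field_derivative_of_nat_powr_minus this, of n] show ?thesis by simp
  qed
  have "(?\<phi> has_field_derivative - of_real (ln (real k)) * of_nat k powr (- (1 + (-1)))
     - (- of_real (ln (real (Suc k))) * of_nat (Suc k) powr (- (1 + (-1))))) (at (-1))"
    by (intro DERIV_diff d)
  then have "deriv ?\<phi> (-1) = - of_real (ln (real k)) * of_nat k powr (- (1 + (-1)))
     - (- of_real (ln (real (Suc k))) * of_nat (Suc k) powr (- (1 + (-1))))"
    by (rule DERIV_imp_deriv)
  then have d1: "deriv ?\<phi> (-1) = of_real (ln (real (Suc k)) - ln (real k))"
    using k of_nat_neq_0[of k, where ?'a = complex] by (simp del: of_nat_Suc)
  have "?\<phi> holomorphic_on UNIV" by (intro holomorphic_intros)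
  then have "(\<lambda>z. if z = -1 then deriv ?\<phi> (-1) else (?\<phi> z - ?\<phi> (-1)) / (z - (-1))) holomorphic_on UNIV"
    by (rule pole_lemma_open) simp
  moreover have "(\<lambda>z. if z = -1 then deriv ?\<phi> (-1) else (?\<phi> z - ?\<phi> (-1)) / (z - (-1))) = newman_weight k"
  proof
    fix z :: complex
    have "?\<phi> (-1) = 0"
      using k of_nat_neq_0[of k, where ?'a = complex] by (simp del: of_nat_Suc)
    moreover have "z - (-1) = 1 + z" by (simp add: add.commute)
    ultimately show "(if z = -1 then deriv ?\<phi> (-1) else (?\<phi> z - ?\<phi> (-1)) / (z - (-1))) = newman_weight k z"
      by (simp only: d1 newman_weight_def diff_zero)
  qed
  ultimately show ?thesis by simp
qed

text \<open>
  This is the estimate \<open>k * x powr (- Re z - 2) \<le> x powr (- Re z - 1)\<close> integrated over \<open>[k, k+1]\<close>, carried out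
  on primitives. Combined with \<open>E k = O(k)\<close> it yields the bound that \<open>newman_tauberian\<close> asks for, with
  \<open>l n = ln (n + 1)\<close>.
\<close>
lemma norm_newman_weight_le:
  assumes k: "k > 0" and x: "Re z \<noteq> 0"
  shows "real k * norm (newman_weight k z) \<le> (real k powr (- Re z) - real (Suc k) powr (- Re z)) / Re z"
proof (cases "z = -1")
  case True
  have "ln (real (Suc k)) - ln (real k) = ln (1 + 1 / real k)"
    using k ln_div[of "real (Suc k)" "real k"] by (simp add: add_divide_distrib add.commute)
  moreover have "0 \<le> ln (1 + 1 / real k)" "ln (1 + 1 / real k) \<le> 1 / real k"
    using k by (auto intro!: ln_add_one_self_le_self)
  ultimately have "norm (newman_weight k z) \<le> 1 / real k"
    unfolding newman_weight_def using True by simp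
  then have "real k * norm (newman_weight k z) \<le> 1" using k by (simp add: field_simps)
  then show ?thesis using True k by simp
next
  case False
  let ?x = "Re z"
  let ?c = "norm (1 + z) / real k"
  have c: "norm (1 + z) > 0" using False by (simp add: add_eq_0_iff)
  have "norm ((\<lambda>t. - (of_real t powr (- (1 + z)))) (real (Suc k)) - (\<lambda>t. - (of_real t powr (- (1 + z)))) (real k) :: complex)
     \<le> (\<lambda>t. - ?c * (t powr (- ?x) / ?x)) (real (Suc k)) - (\<lambda>t. - ?c * (t powr (- ?x) / ?x)) (real k)"
  proof (rule differentiable_bound_general)
    fix t assume t: "real k < t" "t < real (Suc k)"
    then have t0: "t > 0" "t \<ge> real k" by auto
    have "complex_of_real t \<notin> \<real>\<^sub>\<le>\<^sub>0" using t0 by auto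
    then have "((\<lambda>w. - (w powr (- (1 + z)))) has_field_derivative (1 + z) * of_real t powr (- (1 + z) - 1)) (at (of_real t))"
      using DERIV_minus[OF has_field_derivative_powr[of "of_real t" "- (1 + z)"]] by (simp add: algebra_simps)
    then show "((\<lambda>t. - (of_real t powr (- (1 + z)))) has_vector_derivative (1 + z) * of_real t powr (- (1 + z) - 1)) (at t)"
      by (rule has_vector_derivative_real_field)
    show "((\<lambda>t. - ?c * (t powr (- ?x) / ?x)) has_vector_derivative ?c * t powr (- ?x - 1)) (at t)"
      unfolding has_real_derivative_iff_has_vector_derivative[symmetric]
      using t0 x k by (auto intro!: derivative_eq_intros simp: field_simps)
    have "norm ((1 + z) * of_real t powr (- (1 + z) - 1)) = norm (1 + z) * t powr (- ?x - 1 - 1)"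
      unfolding norm_mult using t0 by (subst norm_powr_real_powr) auto
    also have "\<dots> = norm (1 + z) * (t powr (- ?x - 1) / t)"
      unfolding powr_diff[of t "- ?x - 1" 1] using t0 by simp
    also have "\<dots> \<le> norm (1 + z) * (t powr (- ?x - 1) / real k)"
      using t0 k by (intro mult_left_mono divide_left_mono) auto
    finally show "norm ((1 + z) * of_real t powr (- (1 + z) - 1)) \<le> ?c * t powr (- ?x - 1)" by simp
  next
    show "continuous_on {real k..real (Suc k)} (\<lambda>t. - (of_real t powr (- (1 + z))) :: complex)"
      using k by (intro continuous_intros) (auto simp: complex_nonpos_Reals_iff)
    show "continuous_on {real k..real (Suc k)} (\<lambda>t. - ?c * (t powr (- ?x) / ?x))"
      using k x by (intro continuous_intros) auto
  qed auto
  then have D: "norm (of_nat k powr (- (1 + z)) - of_nat (Suc k) powr (- (1 + z)) :: complex)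
     \<le> ?c * ((real k powr (- ?x) - real (Suc k) powr (- ?x)) / ?x)"
    by (simp add: algebra_simps diff_divide_distrib norm_minus_commute del: of_nat_Suc)
  have "real k * norm (newman_weight k z)
      = real k * (norm (of_nat k powr (- (1 + z)) - of_nat (Suc k) powr (- (1 + z)) :: complex) / norm (1 + z))"
    using False by (simp add: newman_weight_def norm_divide)
  also have "\<dots> \<le> real k * (?c * ((real k powr (- ?x) - real (Suc k) powr (- ?x)) / ?x) / norm (1 + z))"
    by (intro mult_left_mono divide_right_mono D) auto
  also have "\<dots> = (real k powr (- ?x) - real (Suc k) powr (- ?x)) / ?x"
    using k c by simp
  finally show ?thesis .
qed

lemma summation_by_parts:
  fixes E w :: "nat \<Rightarrow> 'a :: comm_ring_1"
  shows "(\<Sum>n<N. (E (Suc n) - E n) * w n) = E N * w N - E 0 * w 0 + (\<Sum>n<N. E (Suc n) * (w n - w (Suc n)))"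
  by (induction N) (auto simp: algebra_simps)

text \<open>
  Summation by parts of the Dirichlet series of \<open>\<Lambda> n - 1\<close>; the boundary term is \<open>O(N powr (1 - Re s))\<close>.
\<close>
lemma psi_deviation_series:
  assumes s: "Re s > 1"
  shows "(\<lambda>n. of_real (psi (Suc n) - real (Suc n)) * (of_nat (Suc n) powr (- s) - of_nat (Suc (Suc n)) powr (- s)))
     sums (mangoldt_series s - zeta_series s)"
proof -
  have "(\<lambda>n. mangoldt n * of_nat n powr (- s) - of_nat n powr (- s)) sums (mangoldt_series s - zeta_series s)"
    by (intro sums_diff mangoldt_series_sums zeta_series_sums s)
  then have "(\<lambda>n. mangoldt (Suc n) * of_nat (Suc n) powr (- s) - of_nat (Suc n) powr (- s)) sums (mangoldt_series s - zeta_series s)"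
    by (subst sums_Suc_iff) simp
  moreover have "mangoldt (Suc n) * of_nat (Suc n) powr (- s) - of_nat (Suc n) powr (- s)
      = (of_real (psi (Suc n) - real (Suc n)) - of_real (psi n - real n)) * of_nat (Suc n) powr (- s)" for n
  proof -
    have "mangoldt (Suc n) - 1 = complex_of_real (psi (Suc n) - real (Suc n)) - of_real (psi n - real n)"
      by (simp add: psi_def)
    then show ?thesis by (metis left_diff_distrib mult_1)
  qed
  ultimately have 1: "(\<lambda>N. \<Sum>n<N. (of_real (psi (Suc n) - real (Suc n)) - of_real (psi n - real n)) * of_nat (Suc n) powr (- s))
      \<longlonglongrightarrow> mangoldt_series s - zeta_series s"
    unfolding sums_def by simp
  have 2: "(\<lambda>N. of_real (psi N - real N) * of_nat (Suc N) powr (- s) :: complex) \<longlonglongrightarrow> 0"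
  proof (rule Lim_null_comparison)
    show "\<forall>\<^sub>F N in sequentially. norm (of_real (psi N - real N) * of_nat (Suc N) powr (- s) :: complex) \<le> 4 * real (Suc N) powr (1 - Re s)"
    proof (rule always_eventually, rule allI)
      fix N
      have "psi N \<ge> 0" unfolding psi_def by (intro sum_nonneg mangoldt_nonneg)
      then have "\<bar>psi N - real N\<bar> \<le> 4 * real (Suc N)" using psi_le[of N] by simp
      then have "norm (of_real (psi N - real N) * of_nat (Suc N) powr (- s) :: complex) \<le> 4 * real (Suc N) * real (Suc N) powr (- Re s)"
        unfolding norm_mult norm_of_nat_powr norm_of_real uminus_complex.sel by (intro mult_right_mono) auto
      also have "\<dots> = 4 * real (Suc N) powr (1 - Re s)"
        using powr_add[of "real (Suc N)" 1 "- Re s"] by simp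
      finally show "norm (of_real (psi N - real N) * of_nat (Suc N) powr (- s) :: complex) \<le> 4 * real (Suc N) powr (1 - Re s)" .
    qed
    have "(\<lambda>N. real (Suc N) powr (1 - Re s)) \<longlonglongrightarrow> 0"
      using s by (intro tendsto_neg_powr filterlim_compose[OF filterlim_real_sequentially filterlim_Suc]) auto
    then show "(\<lambda>N. 4 * real (Suc N) powr (1 - Re s)) \<longlonglongrightarrow> 0"
      by (rule tendsto_mult_right_zero)
  qed
  from tendsto_diff[OF 1 2] show ?thesis
    unfolding sums_def summation_by_parts[of "\<lambda>n. of_real (psi n - real n)" "\<lambda>n. of_nat (Suc n) powr (- s)"]
    by (simp add: psi_def)
qed

text \<open>
  Newman's theorem applies to \<open>g s / s\<close> rather than to \<open>g s\<close>: dividing by \<open>s\<close> is what turns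
  \<open>E n * (n\<^sup>-\<^sup>s - (n+1)\<^sup>-\<^sup>s)\<close> into \<open>E n * newman_weight n z\<close>, whose size is controlled without a factor
  \<open>\<bar>s\<bar>\<close>, as the large radius of the contour requires.
\<close>
theorem psi_asymptotics: "(\<lambda>n. psi n / real n) \<longlonglongrightarrow> 1"
proof (rule asymp_of_summable_deviation[OF mono_psi])
  obtain U g where U: "open U" "{s. Re s \<ge> 1} \<subseteq> U" "U \<subseteq> {s. Re s > 0}" "g holomorphic_on U"
    and g: "\<And>s. Re s > 1 \<Longrightarrow> g s = mangoldt_series s - zeta_series s"
    using mangoldt_minus_one_series_extension by blast
  define u where "u = (\<lambda>n z. of_real (psi (Suc n) - real (Suc n)) * newman_weight (Suc n) z)"
  let ?V = "(\<lambda>z. 1 + z) -` U"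
  have "(\<lambda>n. u n 0) sums (g (1 + 0) / (1 + 0))"
  proof (rule newman_tauberian[where l = "\<lambda>n. ln (real (Suc n))" and C = 4 and U = ?V])
    show "u n holomorphic_on UNIV" for n
      unfolding u_def by (intro holomorphic_intros holomorphic_newman_weight) simp
    show "filterlim (\<lambda>n. ln (real (Suc n))) at_top sequentially"
      by (intro filterlim_compose[OF ln_at_top] filterlim_compose[OF filterlim_real_sequentially filterlim_Suc])
    show "norm (u n z) \<le> 4 * ((exp (- Re z * ln (real (Suc n))) - exp (- Re z * ln (real (Suc (Suc n))))) / Re z)"
      if "Re z \<noteq> 0" for n z
    proof -
      have "psi (Suc n) \<ge> 0" unfolding psi_def by (intro sum_nonneg mangoldt_nonneg)
      then have "\<bar>psi (Suc n) - real (Suc n)\<bar> \<le> 4 * real (Suc n)" using psi_le[of "Suc n"] by (simp add: abs_le_iff)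
      then have "norm (u n z) \<le> 4 * real (Suc n) * norm (newman_weight (Suc n) z)"
        unfolding u_def norm_mult norm_of_real by (intro mult_right_mono) auto
      also have "\<dots> \<le> 4 * ((real (Suc n) powr (- Re z) - real (Suc (Suc n)) powr (- Re z)) / Re z)"
        unfolding mult.assoc using norm_newman_weight_le[of "Suc n" z] that by (intro mult_left_mono) auto
      finally show ?thesis by (simp add: powr_def)
    qed
    show "open ?V" by (rule open_vimage[OF U(1)]) (intro continuous_intros)
    show "{z. Re z \<ge> 0} \<subseteq> ?V" by (auto intro!: subsetD[OF U(2)])
    have "(g \<circ> (\<lambda>z. 1 + z)) holomorphic_on ?V"
      by (rule holomorphic_on_compose_gen[OF _ U(4)]) (auto intro!: holomorphic_intros)
    then show "(\<lambda>z. g (1 + z) / (1 + z)) holomorphic_on ?V"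
      using U(3) by (intro holomorphic_on_divide holomorphic_intros) (auto simp: o_def)
    show "(\<lambda>n. u n z) sums (g (1 + z) / (1 + z))" if z: "Re z > 0" for z
    proof -
      have s: "Re (1 + z) > 1" "z \<noteq> -1" using z by auto
      have "u n z = of_real (psi (Suc n) - real (Suc n)) * (of_nat (Suc n) powr (- (1 + z)) - of_nat (Suc (Suc n)) powr (- (1 + z))) / (1 + z)" for n
        unfolding u_def newman_weight_def using s(2) by simp
      then show ?thesis
        unfolding g[OF s(1)] by (simp only:) (rule sums_divide[OF psi_deviation_series[OF s(1)]])
    qed
  qed simp_all
  moreover have "u n 0 = of_real ((psi (Suc n) - real (Suc n)) / (real (Suc n) * (real (Suc n) + 1)))" for n
  proof -
    have "newman_weight (Suc n) 0 = of_real (1 / real (Suc n) - 1 / real (Suc (Suc n)))"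
      by (simp add: newman_weight_def powr_minus divide_inverse del: of_nat_Suc)
    also have "1 / real (Suc n) - 1 / real (Suc (Suc n)) = 1 / (real (Suc n) * (real (Suc n) + 1))"
      by (simp add: field_simps)
    finally show ?thesis by (simp add: u_def)
  qed
  ultimately have "summable (\<lambda>n. of_real ((psi (Suc n) - real (Suc n)) / (real (Suc n) * (real (Suc n) + 1))) :: complex)"
    by (simp add: sums_iff del: of_real_divide)
  then have "summable (\<lambda>n. (psi (Suc n) - real (Suc n)) / (real (Suc n) * (real (Suc n) + 1)))"
    by (simp only: summable_complex_of_real)
  then show "summable (\<lambda>k. (psi k - real k) / (real k * (real k + 1)))"
    by (rule summable_Suc_iff[THEN iffD1])
qed

section \<open>The prime number theorem\<close>

lemma linear_bound_of_sublinear: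
  fixes E :: "nat \<Rightarrow> real"
  assumes E: "(\<lambda>n. E n / real n) \<longlonglongrightarrow> 0" and e: "e > 0"
  obtains C where "C \<ge> 0" "\<And>n. \<bar>E n\<bar> \<le> e * real n + C"
proof -
  have "\<forall>\<^sub>F n in sequentially. \<bar>E n / real n\<bar> < e"
    using E e unfolding tendsto_iff dist_real_def by auto
  then obtain K where K: "\<And>n. n \<ge> K \<Longrightarrow> \<bar>E n / real n\<bar> < e"
    unfolding eventually_sequentially by auto
  define C where "C = (\<Sum>n\<le>K. \<bar>E n\<bar>)"
  have C: "C \<ge> 0" unfolding C_def by (intro sum_nonneg) auto
  have "\<bar>E n\<bar> \<le> e * real n + C" for n
  proof (cases "n \<le> K")
    case True
    then have "\<bar>E n\<bar> \<le> C" unfolding C_def by (intro member_le_sum) auto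
    then show ?thesis using e by (simp add: add_increasing)
  next
    case False
    then have "\<bar>E n\<bar> \<le> e * real n" using K[of n] by (simp add: field_simps)
    then show ?thesis using C by simp
  qed
  then show ?thesis using that C by blast
qed

text \<open>
  Dividing by a decreasing weight preserves smallness on average. With \<open>\<bar>E n\<bar> \<le> e * n + C\<close>, summation by
  parts bounds the numerator by the same expression with \<open>e * n + C\<close> in place of \<open>E n\<close>, and reading the
  summation by parts backwards evaluates that to \<open>e * \<Sum>w + C * w 0\<close>.
\<close>
lemma weighted_sum_sublinear:
  fixes E w :: "nat \<Rightarrow> real"
  assumes E: "(\<lambda>n. E n / real n) \<longlonglongrightarrow> 0" and E0: "E 0 = 0"
    and w: "\<And>n. w (Suc n) \<le> w n" "\<And>n. w n \<ge> 0"
    and W: "filterlim (\<lambda>N. \<Sum>n<N. w n) at_top sequentially"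
  shows "(\<lambda>N. (\<Sum>n<N. (E (Suc n) - E n) * w n) / (\<Sum>n<N. w n)) \<longlonglongrightarrow> 0"
  unfolding tendsto_iff
proof (intro allI impI)
  fix e0 :: real assume e0: "e0 > 0"
  define e where "e = e0 / 3"
  have e: "e > 0" using e0 by (simp add: e_def)
  obtain C where C: "C \<ge> 0" "\<And>n. \<bar>E n\<bar> \<le> e * real n + C"
    using linear_bound_of_sublinear[OF E e] by blast
  have bd: "\<bar>\<Sum>n<N. (E (Suc n) - E n) * w n\<bar> \<le> e * (\<Sum>n<N. w n) + C * w 0" for N
  proof -
    have "\<bar>\<Sum>n<N. (E (Suc n) - E n) * w n\<bar> \<le> \<bar>E N * w N\<bar> + \<bar>\<Sum>n<N. E (Suc n) * (w n - w (Suc n))\<bar>"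
      unfolding summation_by_parts[of E w] E0 by simp
    also have "\<dots> \<le> (e * real N + C) * w N + (\<Sum>n<N. (e * real (Suc n) + C) * (w n - w (Suc n)))"
    proof (rule add_mono)
      show "\<bar>E N * w N\<bar> \<le> (e * real N + C) * w N"
        unfolding abs_mult using C e w by (intro mult_mono add_nonneg_nonneg) auto
      show "\<bar>\<Sum>n<N. E (Suc n) * (w n - w (Suc n))\<bar> \<le> (\<Sum>n<N. (e * real (Suc n) + C) * (w n - w (Suc n)))"
        using w(1) C(2) by (intro order_trans[OF sum_abs] sum_mono) (simp add: abs_mult mult_right_mono del: of_nat_Suc)
    qed
    also have "\<dots> = (\<Sum>n<N. ((e * real (Suc n) + C) - (e * real n + C)) * w n) + C * w 0"
      unfolding summation_by_parts[of "\<lambda>n. e * real n + C" w] by simp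
    also have "(\<Sum>n<N. ((e * real (Suc n) + C) - (e * real n + C)) * w n) = e * (\<Sum>n<N. w n)"
      unfolding sum_distrib_left by (intro sum.cong refl) (simp add: algebra_simps)
    finally show ?thesis .
  qed
  have "\<forall>\<^sub>F N in sequentially. (\<Sum>n<N. w n) \<ge> max 1 (C * w 0 / e)"
    using W unfolding filterlim_at_top by blast
  then show "\<forall>\<^sub>F N in sequentially. dist ((\<Sum>n<N. (E (Suc n) - E n) * w n) / (\<Sum>n<N. w n)) 0 < e0"
  proof eventually_elim
    case (elim N)
    let ?W = "\<Sum>n<N. w n"
    have pos: "?W > 0" using elim by simp
    have "C * w 0 \<le> e * ?W" using elim e by (simp add: field_simps)
    then have "\<bar>\<Sum>n<N. (E (Suc n) - E n) * w n\<bar> \<le> 2 * e * ?W" using bd[of N] by simp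
    also have "\<dots> < e0 * ?W" using pos e0 by (simp add: e_def)
    finally show ?case using pos by (simp add: dist_real_def abs_divide field_simps)
  qed
qed

text \<open>
  A proper prime power \<open>p ^ j \<le> n\<close> has \<open>p \<le> sqrt n\<close>, as \<open>j \<ge> 2\<close>, and \<open>j \<le> log 2 n\<close>, as \<open>p \<ge> 2\<close>.
\<close>
lemma card_nonprime_primepow_le:
  "real (card {k \<in> {1..n}. primepow k \<and> \<not> prime k}) \<le> (sqrt (real n) + 1) * (log 2 (real n) + 1)"
proof (cases "n = 0")
  case False
  let ?P = "{..nat \<lfloor>sqrt (real n)\<rfloor>}" and ?J = "{..nat \<lfloor>log 2 (real n)\<rfloor>}"
  have "{k \<in> {1..n}. primepow k \<and> \<not> prime k} \<subseteq> (\<lambda>(p, j). p ^ j) ` (?P \<times> ?J)"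
  proof
    fix k assume "k \<in> {k \<in> {1..n}. primepow k \<and> \<not> prime k}"
    then obtain p j where k: "k \<le> n" "k = p ^ j" "prime p" "j > 0" "\<not> prime k"
      by (auto simp: primepow_def)
    have j: "j \<ge> 2" using k by (cases "j = 1") auto
    have p: "p \<ge> 2" using k prime_ge_2_nat by blast
    have "p ^ 2 \<le> p ^ j" using j p by (intro power_increasing) auto
    then have "real (p ^ 2) \<le> real n" using k by (simp only: of_nat_le_iff)
    then have "real p \<le> sqrt (real n)" by (intro real_le_rsqrt) simp
    moreover have "2 ^ j \<le> p ^ j" using p by (intro power_mono) auto
    then have "real (2 ^ j) \<le> real n" using k by (simp only: of_nat_le_iff)
    then have "real j \<le> log 2 (real n)" using False by (simp add: le_log_of_power)
    ultimately have "p \<in> ?P" "j \<in> ?J" by (auto simp: le_nat_floor)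
    then show "k \<in> (\<lambda>(p, j). p ^ j) ` (?P \<times> ?J)" using k(2) by auto
  qed
  then have "card {k \<in> {1..n}. primepow k \<and> \<not> prime k} \<le> card ((\<lambda>(p, j). p ^ j) ` (?P \<times> ?J))"
    by (rule card_mono[rotated]) auto
  also have "\<dots> \<le> card (?P \<times> ?J)" by (rule card_image_le) auto
  also have "\<dots> = (nat \<lfloor>sqrt (real n)\<rfloor> + 1) * (nat \<lfloor>log 2 (real n)\<rfloor> + 1)"
    by (simp add: card_cartesian_product)
  finally have "real (card {k \<in> {1..n}. primepow k \<and> \<not> prime k})
      \<le> real ((nat \<lfloor>sqrt (real n)\<rfloor> + 1) * (nat \<lfloor>log 2 (real n)\<rfloor> + 1))"
    by (rule of_nat_mono)
  also have "\<dots> = (real (nat \<lfloor>sqrt (real n)\<rfloor>) + 1) * (real (nat \<lfloor>log 2 (real n)\<rfloor>) + 1)"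
    by (simp only: of_nat_mult of_nat_add of_nat_1)
  also have "\<dots> \<le> (sqrt (real n) + 1) * (log 2 (real n) + 1)"
    using False by (intro mult_mono add_mono order_refl of_nat_floor) (auto simp: log_def intro!: add_nonneg_nonneg divide_nonneg_nonneg)
  finally show ?thesis .
qed (simp add: log_def)

definition theta :: "nat \<Rightarrow> real" where
  "theta n = (\<Sum>k=1..n. a k * ln (real k))"

lemma psi_minus_theta_bounds:
  "0 \<le> psi n - theta n" "psi n - theta n \<le> (sqrt (real n) + 1) * (log 2 (real n) + 1) * ln (real n)"
proof -
  let ?Q = "{k \<in> {1..n}. primepow k \<and> \<not> prime k}"
  have "psi n - theta n = (\<Sum>k=1..n. mangoldt k - a k * ln (real k))"
    by (simp add: psi_def theta_def sum_subtractf)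
  also have "\<dots> = (\<Sum>k=1..n. if primepow k \<and> \<not> prime k then mangoldt k else 0)"
    by (intro sum.cong refl) (auto simp: a_def mangoldt_def)
  also have "\<dots> = (\<Sum>k\<in>?Q. mangoldt k)"
    by (subst sum.inter_filter) auto
  finally have eq: "psi n - theta n = (\<Sum>k\<in>?Q. mangoldt k)" .
  show "0 \<le> psi n - theta n" unfolding eq by (intro sum_nonneg mangoldt_nonneg)
  show "psi n - theta n \<le> (sqrt (real n) + 1) * (log 2 (real n) + 1) * ln (real n)"
  proof (cases "n = 0")
    case False
    have "psi n - theta n \<le> (\<Sum>k\<in>?Q. ln (real n))"
      unfolding eq
    proof (intro sum_mono)
      fix k assume k: "k \<in> ?Q"
      then have "mangoldt k \<le> ln (real k)" by (intro mangoldt_le) auto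
      also have "\<dots> \<le> ln (real n)" using k by (intro ln_mono) auto
      finally show "mangoldt k \<le> ln (real n)" .
    qed
    also have "\<dots> = real (card ?Q) * ln (real n)" by simp
    also have "\<dots> \<le> (sqrt (real n) + 1) * (log 2 (real n) + 1) * ln (real n)"
      using False by (intro mult_right_mono card_nonprime_primepow_le) simp
    finally show ?thesis .
  qed (simp add: psi_def theta_def)
qed

lemma theta_asymptotics: "(\<lambda>n. (theta n - real n) / real n) \<longlonglongrightarrow> 0"
proof -
  have "(\<lambda>n. (psi n - theta n) / real n) \<longlonglongrightarrow> 0"
  proof (rule tendsto_sandwich)
    show "\<forall>\<^sub>F n in sequentially. 0 \<le> (psi n - theta n) / real n"
      by (intro always_eventually allI divide_nonneg_nonneg psi_minus_theta_bounds) auto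
    show "\<forall>\<^sub>F n in sequentially. (psi n - theta n) / real n
        \<le> (sqrt (real n) + 1) * (log 2 (real n) + 1) * ln (real n) / real n"
      by (intro always_eventually allI divide_right_mono psi_minus_theta_bounds) auto
    show "(\<lambda>n. (sqrt (real n) + 1) * (log 2 (real n) + 1) * ln (real n) / real n) \<longlonglongrightarrow> 0"
      unfolding log_def by real_asymp
  qed simp
  from tendsto_diff[OF tendsto_diff[OF psi_asymptotics this] tendsto_const[of 1]]
  have "(\<lambda>n. psi n / real n - (psi n - theta n) / real n - 1) \<longlonglongrightarrow> 0" by simp
  then show ?thesis
    by (rule Lim_transform_eventually)
       (use eventually_gt_at_top[of 0] in eventually_elim, simp add: field_simps)
qed

text \<open>
  The weight \<open>1 / ln (n + 1)\<close> applied to the increments of \<open>theta n - n\<close> gives \<open>a (n+1) - b (n+1)\<close>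
  except at \<open>n = 0\<close>, where \<open>ln 1 = 0\<close>; replacing the argument by \<open>max 2 (n + 1)\<close> costs only the
  constant \<open>c\<close>, which is negligible against the diverging sum of \<open>b\<close>.
\<close>
theorem prime_number_theorem:
  "filterlim (\<lambda>n. \<Sum>k=1..n. b k) at_top sequentially"
  "(\<lambda>n. ((\<Sum>k=1..n. a k) - (\<Sum>k=1..n. b k)) / (\<Sum>k=1..n. b k)) \<longlonglongrightarrow> 0"
proof -
  define w where "w = (\<lambda>n. 1 / ln (real (max 2 (Suc n))))"
  define E where "E = (\<lambda>n. theta n - real n)"
  define c where "c = 1 / ln (2 :: real)"
  let ?W = "\<lambda>N. \<Sum>n<N. w n" and ?S = "\<lambda>N. \<Sum>n<N. (E (Suc n) - E n) * w n"
  have w: "w (Suc n) \<le> w n" "w n \<ge> 0" for n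
    unfolding w_def by (intro divide_left_mono mult_pos_pos ln_mono) auto
  have W: "filterlim ?W at_top sequentially"
  proof (rule filterlim_at_top_mono)
    show "filterlim (\<lambda>N. real N * (1 / ln (real N))) at_top sequentially" by real_asymp
    show "\<forall>\<^sub>F N in sequentially. real N * (1 / ln (real N)) \<le> ?W N"
      using eventually_ge_at_top[of 2]
    proof eventually_elim
      case (elim N)
      have "(\<Sum>n<N. 1 / ln (real N)) \<le> ?W N"
        unfolding w_def using elim by (intro sum_mono divide_left_mono ln_mono mult_pos_pos) auto
      then show ?case by simp
    qed
  qed
  have sumb: "(\<Sum>k=1..N. b k) = ?W N - c" if "N > 0" for N
    using that
  proof (induction N)
    case (Suc N)
    then show ?case
      by (cases "N = 0") (auto simp: b_def w_def c_def max_def)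
  qed simp
  have sumab: "(\<Sum>k=1..N. a k) - (\<Sum>k=1..N. b k) = ?S N + c" if "N > 0" for N
    using that
  proof (induction N)
    case (Suc N)
    have d: "E (Suc N) - E N = a (Suc N) * ln (real (Suc N)) - 1" by (simp add: E_def theta_def)
    show ?case
    proof (cases "N = 0")
      case True
      then show ?thesis by (simp add: E_def theta_def a_def b_def w_def c_def)
    next
      case False
      then have "(E (Suc N) - E N) * w N = a (Suc N) - b (Suc N)"
        unfolding d by (simp add: w_def b_def max_def diff_divide_distrib del: of_nat_Suc)
      then show ?thesis using Suc False by simp
    qed
  qed simp
  have E: "(\<lambda>n. E n / real n) \<longlonglongrightarrow> 0" unfolding E_def by (rule theta_asymptotics)
  have SW: "(\<lambda>N. ?S N / ?W N) \<longlonglongrightarrow> 0"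
    by (rule weighted_sum_sublinear[OF E _ w W]) (simp add: E_def theta_def)
  have cW: "(\<lambda>N. c / ?W N) \<longlonglongrightarrow> 0"
    by (rule tendsto_divide_0[OF tendsto_const filterlim_at_top_imp_at_infinity[OF W]])
  have "filterlim (\<lambda>N. - c + ?W N) at_top sequentially"
    by (rule filterlim_tendsto_add_at_top[OF tendsto_const W])
  then show "filterlim (\<lambda>n. \<Sum>k=1..n. b k) at_top sequentially"
    by (rule filterlim_mono_eventually[OF _ order_refl order_refl])
       (use eventually_gt_at_top[of 0] in eventually_elim, simp add: sumb[simplified])
  have "(\<lambda>N. (?S N / ?W N + c / ?W N) / (1 - c / ?W N)) \<longlonglongrightarrow> (0 + 0) / (1 - 0)"
    by (intro tendsto_intros SW cW) auto
  moreover have "\<forall>\<^sub>F N in sequentially. (?S N / ?W N + c / ?W N) / (1 - c / ?W N)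
      = ((\<Sum>k=1..N. a k) - (\<Sum>k=1..N. b k)) / (\<Sum>k=1..N. b k)"
    using eventually_gt_at_top[of 0] filterlim_at_top_dense[THEN iffD1, OF W, rule_format, of 0]
  proof eventually_elim
    case (elim N)
    then show ?case unfolding sumab[OF elim(1)] unfolding sumb[OF elim(1)]
      by (simp add: add_divide_distrib[symmetric] diff_divide_eq_iff)
  qed
  ultimately show "(\<lambda>n. ((\<Sum>k=1..n. a k) - (\<Sum>k=1..n. b k)) / (\<Sum>k=1..n. b k)) \<longlonglongrightarrow> 0"
    by (auto dest: Lim_transform_eventually)
qed

section \<open>Sums over primes weighted by a monotone function\<close>

text \<open>
  A step function is constant on each \<open>[n, n+1)\<close>, so the fundamental theorem applies piece by piece;
  the derivative \<open>f'\<close> need not be continuous for the Henstock--Kurzweil integral.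
\<close>
lemma integral_step_function_deriv:
  fixes f f' :: "real \<Rightarrow> real" and c :: "nat \<Rightarrow> real"
  assumes deriv: "\<And>x. x \<ge> 1 \<Longrightarrow> (f has_real_derivative f' x) (at x within {1..})" and n: "n > 0"
  shows "((\<lambda>t. (\<Sum>k\<in>{1..nat \<lfloor>t\<rfloor>}. c k) * f' t) has_integral
    (\<Sum>k=1..<n. (\<Sum>j=1..k. c j) * (f (real (Suc k)) - f (real k)))) {1..real n}"
  using n
proof (induction n rule: nat_induct_non_zero)
  case 1
  show ?case by (simp add: has_integral_refl)
next
  case (Suc n)
  let ?C = "\<lambda>n. \<Sum>j=1..n. c j"
  have "(f' has_integral (f (real (Suc n)) - f (real n))) {real n..real (Suc n)}"
  proof (rule fundamental_theorem_of_calculus)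
    fix x assume "x \<in> {real n..real (Suc n)}"
    then have "(f has_real_derivative f' x) (at x within {real n..real (Suc n)})"
      using Suc by (intro DERIV_subset[OF deriv]) auto
    then show "(f has_vector_derivative f' x) (at x within {real n..real (Suc n)})"
      by (simp add: has_real_derivative_iff_has_vector_derivative)
  qed simp
  then have "((\<lambda>t. ?C n * f' t) has_integral (?C n * (f (real (Suc n)) - f (real n)))) {real n..real (Suc n)}"
    by (rule has_integral_mult_right)
  then have "((\<lambda>t. ?C (nat \<lfloor>t\<rfloor>) * f' t) has_integral (?C n * (f (real (Suc n)) - f (real n)))) {real n..real (Suc n)}"
  proof (rule has_integral_spike_finite[rotated 2, of _ _ _ "{real (Suc n)}"])
    fix t assume "t \<in> {real n..real (Suc n)} - {real (Suc n)}"
    then have "\<lfloor>t\<rfloor> = int n" by (intro floor_unique) auto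
    then show "?C (nat \<lfloor>t\<rfloor>) * f' t = ?C n * f' t" by simp
  qed simp
  from has_integral_combine[OF _ _ Suc.IH this] show ?case using Suc.hyps by simp
qed

lemma abel_summation_differences:
  fixes c g :: "nat \<Rightarrow> real"
  assumes "n > 0"
  shows "(\<Sum>k=1..n. c k * g k) = (\<Sum>k=1..n. c k) * g n - (\<Sum>k=1..<n. (\<Sum>j=1..k. c j) * (g (Suc k) - g k))"
  using assms by (induction n rule: nat_induct_non_zero) (auto simp: algebra_simps)

text \<open>
  A Stolz-type statement: since the increments \<open>\<Delta> k\<close> have one sign, \<open>\<bar>\<Sum>B k * \<Delta> k\<bar>\<close> is the sum of the
  absolute values, so \<open>\<bar>A k - B k\<bar> \<le> e * B k\<close> for \<open>k \<ge> K\<close> bounds the numerator by \<open>e\<close> times the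
  denominator, up to the finitely many terms with \<open>k < K\<close>.
\<close>
lemma monotone_weights_ratio:
  fixes A B \<Delta> :: "nat \<Rightarrow> real"
  assumes B: "\<And>k. B k \<ge> 0" and AB: "(\<lambda>k. (A k - B k) / B k) \<longlonglongrightarrow> 0"
    and B_pos: "\<forall>\<^sub>F k in sequentially. B k > 0"
    and sgn: "(\<forall>k\<ge>1. \<Delta> k \<ge> 0) \<or> (\<forall>k\<ge>1. \<Delta> k \<le> 0)"
    and infty: "filterlim (\<lambda>n. \<bar>\<Sum>k=1..<n. B k * \<Delta> k\<bar>) at_top sequentially"
  shows "(\<lambda>n. ((\<Sum>k=1..<n. A k * \<Delta> k) - (\<Sum>k=1..<n. B k * \<Delta> k)) / (\<Sum>k=1..<n. B k * \<Delta> k)) \<longlonglongrightarrow> 0"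
  unfolding tendsto_iff
proof (intro allI impI)
  fix e0 :: real assume e0: "e0 > 0"
  define e where "e = e0 / 3"
  have e: "e > 0" using e0 by (simp add: e_def)
  let ?I = "\<lambda>n. \<Sum>k=1..<n. B k * \<Delta> k"
  have absI: "\<bar>?I n\<bar> = (\<Sum>k=1..<n. B k * \<bar>\<Delta> k\<bar>)" for n
    using sgn
  proof
    assume "\<forall>k\<ge>1. \<Delta> k \<ge> 0"
    then have "?I n = (\<Sum>k=1..<n. B k * \<bar>\<Delta> k\<bar>)" by (intro sum.cong) auto
    then show ?thesis using B by (simp add: sum_nonneg)
  next
    assume "\<forall>k\<ge>1. \<Delta> k \<le> 0"
    then have "- ?I n = (\<Sum>k=1..<n. B k * \<bar>\<Delta> k\<bar>)"
      unfolding sum_negf[symmetric] by (intro sum.cong) (auto simp: abs_of_nonpos)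
    moreover have "(\<Sum>k=1..<n. B k * \<bar>\<Delta> k\<bar>) \<ge> 0" using B by (simp add: sum_nonneg)
    ultimately show ?thesis by linarith
  qed
  have "\<forall>\<^sub>F k in sequentially. \<bar>(A k - B k) / B k\<bar> < e"
    using AB e unfolding tendsto_iff dist_real_def by auto
  then have "\<forall>\<^sub>F k in sequentially. \<bar>A k - B k\<bar> \<le> e * B k"
    using B_pos by eventually_elim (simp add: abs_divide field_simps)
  then obtain K where K: "\<And>k. k \<ge> K \<Longrightarrow> \<bar>A k - B k\<bar> \<le> e * B k"
    unfolding eventually_sequentially by auto
  define M where "M = (\<Sum>k<K. \<bar>A k - B k\<bar> * \<bar>\<Delta> k\<bar>)"
  have bd: "\<bar>(\<Sum>k=1..<n. A k * \<Delta> k) - ?I n\<bar> \<le> M + e * \<bar>?I n\<bar>" for n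
  proof -
    have "\<bar>(\<Sum>k=1..<n. A k * \<Delta> k) - ?I n\<bar> = \<bar>\<Sum>k=1..<n. (A k - B k) * \<Delta> k\<bar>"
      by (simp add: sum_subtractf left_diff_distrib)
    also have "\<dots> \<le> (\<Sum>k=1..<n. \<bar>A k - B k\<bar> * \<bar>\<Delta> k\<bar>)"
      by (rule order_trans[OF sum_abs]) (simp add: abs_mult)
    also have "\<dots> \<le> (\<Sum>k=1..<n. (if k < K then \<bar>A k - B k\<bar> * \<bar>\<Delta> k\<bar> else 0) + e * (B k * \<bar>\<Delta> k\<bar>))"
    proof (intro sum_mono)
      fix k
      show "\<bar>A k - B k\<bar> * \<bar>\<Delta> k\<bar> \<le> (if k < K then \<bar>A k - B k\<bar> * \<bar>\<Delta> k\<bar> else 0) + e * (B k * \<bar>\<Delta> k\<bar>)"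
        using K[of k] B[of k] e mult_right_mono[of "\<bar>A k - B k\<bar>" "e * B k" "\<bar>\<Delta> k\<bar>"] by (auto simp: mult_ac)
    qed
    also have "\<dots> = (\<Sum>k\<in>{1..<n} \<inter> {..<K}. \<bar>A k - B k\<bar> * \<bar>\<Delta> k\<bar>) + e * \<bar>?I n\<bar>"
      unfolding absI sum.distrib sum_distrib_left by (simp add: sum.inter_restrict)
    also have "(\<Sum>k\<in>{1..<n} \<inter> {..<K}. \<bar>A k - B k\<bar> * \<bar>\<Delta> k\<bar>) \<le> M"
      unfolding M_def by (intro sum_mono2) auto
    finally show ?thesis by simp
  qed
  have "\<forall>\<^sub>F n in sequentially. \<bar>?I n\<bar> \<ge> max 1 (M / e)"
    using infty unfolding filterlim_at_top by blast
  then show "\<forall>\<^sub>F n in sequentially. dist (((\<Sum>k=1..<n. A k * \<Delta> k) - ?I n) / ?I n) 0 < e0"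
  proof eventually_elim
    case (elim n)
    have pos: "\<bar>?I n\<bar> > 0" using elim by linarith
    have "M \<le> e * \<bar>?I n\<bar>" using elim e by (simp add: field_simps)
    then have "\<bar>(\<Sum>k=1..<n. A k * \<Delta> k) - ?I n\<bar> \<le> 2 * e * \<bar>?I n\<bar>" using bd[of n] by linarith
    also have "\<dots> < e0 * \<bar>?I n\<bar>" using pos e0 by (simp add: e_def)
    finally have "\<bar>(\<Sum>k=1..<n. A k * \<Delta> k) - ?I n\<bar> / \<bar>?I n\<bar> < e0"
      using pos by (simp add: pos_divide_less_eq)
    then show ?case by (simp add: dist_real_def abs_divide)
  qed
qed

text \<open>
  If \<open>y n / x n\<close> stays at distance \<open>d\<close> from 1, then \<open>\<bar>x n - y n\<bar> \<ge> d * \<bar>x n\<bar>\<close>, so \<open>x n\<close> and \<open>y n\<close> are both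
  \<open>O(x n - y n)\<close>, and relative errors \<open>\<alpha> n\<close>, \<open>\<beta> n\<close> of \<open>x' n\<close>, \<open>y' n\<close> stay small relative to the difference.
  This treats finite and infinite limits \<open>L\<close> alike, and also indices with \<open>x n = 0\<close>, where
  \<open>y n / x n = 0\<close> by convention and \<open>y n \<noteq> 0\<close> saves the denominator.
\<close>
lemma ratio_of_differences:
  fixes x y x' y' :: "nat \<Rightarrow> real"
  assumes L: "(\<lambda>n. ereal (y n / x n)) \<longlonglongrightarrow> L" "L \<noteq> 1"
    and y: "\<forall>\<^sub>F n in sequentially. y n \<noteq> 0"
    and \<alpha>: "\<alpha> \<longlonglongrightarrow> 0" "\<forall>\<^sub>F n in sequentially. x' n - x n = \<alpha> n * x n"
    and \<beta>: "\<beta> \<longlonglongrightarrow> 0" "\<forall>\<^sub>F n in sequentially. y' n - y n = \<beta> n * y n"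
  shows "(\<lambda>n. (x' n - y' n) / (x n - y n)) \<longlonglongrightarrow> 1"
proof -
  obtain d where d: "d > 0" "\<forall>\<^sub>F n in sequentially. \<bar>y n / x n - 1\<bar> > d"
  proof (cases "L < 1")
    case True
    then obtain c :: real where c: "L < ereal c" "ereal c < 1" using ereal_dense2 by blast
    then have "1 - c > 0" "\<forall>\<^sub>F n in sequentially. \<bar>y n / x n - 1\<bar> > 1 - c"
      using order_tendstoD(2)[OF L(1) c(1)] c(2) by (auto elim!: eventually_mono)
    then show ?thesis using that by blast
  next
    case False
    then have "1 < L" using L(2) by simp
    then obtain c :: real where c: "ereal c < L" "1 < ereal c" using ereal_dense2 by blast
    then have "c - 1 > 0" "\<forall>\<^sub>F n in sequentially. \<bar>y n / x n - 1\<bar> > c - 1"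
      using order_tendstoD(1)[OF L(1) c(1)] c(2) by (auto elim!: eventually_mono)
    then show ?thesis using that by blast
  qed
  define M where "M = 1 / d + 1"
  have "(\<lambda>n. (x' n - y' n) / (x n - y n) - 1) \<longlonglongrightarrow> 0"
  proof (rule Lim_null_comparison)
    show "\<forall>\<^sub>F n in sequentially. norm ((x' n - y' n) / (x n - y n) - 1) \<le> \<bar>\<alpha> n\<bar> * M + \<bar>\<beta> n\<bar> * M"
      using d(2) y \<alpha>(2) \<beta>(2)
    proof eventually_elim
      case (elim n)
      have M: "M \<ge> 1" "1 / d \<le> M" using d(1) by (auto simp: M_def)
      have bounds: "x n - y n \<noteq> 0 \<and> \<bar>x n / (x n - y n)\<bar> \<le> M \<and> \<bar>y n / (x n - y n)\<bar> \<le> M"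
      proof (cases "x n = 0")
        case True
        then show ?thesis using elim(2) M by simp
      next
        case False
        have "d * \<bar>x n\<bar> < \<bar>y n / x n - 1\<bar> * \<bar>x n\<bar>" using elim(1) False by (intro mult_strict_right_mono) auto
        also have "\<dots> = \<bar>x n - y n\<bar>" using False by (simp add: abs_mult[symmetric] field_simps abs_minus_commute)
        finally have lt: "d * \<bar>x n\<bar> < \<bar>x n - y n\<bar>" .
        then have ne: "x n - y n \<noteq> 0" using d(1) by (smt (verit) mult_nonneg_nonneg)
        have x: "\<bar>x n / (x n - y n)\<bar> \<le> 1 / d"
          using lt ne d(1) by (simp add: abs_divide field_simps)
        have "y n / (x n - y n) = x n / (x n - y n) - 1" using ne by (simp add: field_simps)
        then have "\<bar>y n / (x n - y n)\<bar> \<le> M" using x unfolding M_def by linarith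
        then show ?thesis using ne x M by linarith
      qed
      then have ne: "x n - y n \<noteq> 0" by simp
      have num: "(x' n - y' n) - (x n - y n) = \<alpha> n * x n - \<beta> n * y n" using elim(3,4) by linarith
      have "(x' n - y' n) / (x n - y n) - 1 = ((x' n - y' n) - (x n - y n)) / (x n - y n)"
        using ne by (subst diff_divide_distrib) simp
      also have "\<dots> = \<alpha> n * (x n / (x n - y n)) - \<beta> n * (y n / (x n - y n))"
        unfolding num by (simp add: diff_divide_distrib)
      finally have "norm ((x' n - y' n) / (x n - y n) - 1) = \<bar>\<alpha> n * (x n / (x n - y n)) - \<beta> n * (y n / (x n - y n))\<bar>" by simp
      also have "\<dots> \<le> \<bar>\<alpha> n\<bar> * \<bar>x n / (x n - y n)\<bar> + \<bar>\<beta> n\<bar> * \<bar>y n / (x n - y n)\<bar>"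
        unfolding abs_mult[symmetric] by (rule abs_triangle_ineq4)
      also have "\<dots> \<le> \<bar>\<alpha> n\<bar> * M + \<bar>\<beta> n\<bar> * M"
        using bounds by (intro add_mono mult_left_mono) auto
      finally show ?case .
    qed
    have "(\<lambda>n. \<bar>\<alpha> n\<bar> * M + \<bar>\<beta> n\<bar> * M) \<longlonglongrightarrow> \<bar>0\<bar> * M + \<bar>0\<bar> * M"
      by (intro tendsto_intros \<alpha> \<beta>)
    then show "(\<lambda>n. \<bar>\<alpha> n\<bar> * M + \<bar>\<beta> n\<bar> * M) \<longlonglongrightarrow> 0" by simp
  qed
  then show ?thesis by (simp add: LIM_zero_iff)
qed

theorem mainTheorem4:
  fixes f f' :: "real \<Rightarrow> real"
  assumes deriv: "\<And>x. x \<ge> 1 \<Longrightarrow> (f has_real_derivative f' x) (at x within {1..})"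
    and ratio_limit: "\<exists>L::ereal. L \<noteq> 1 \<and>
      (\<lambda>n::nat. ereal (integral {1..real n} (\<lambda>t. B t * f' t) / (B (real n) * f (real n))))
        \<longlonglongrightarrow> L"
    and monotone: "mono_on {1..} f \<or> antimono_on {1..} f"
    and deriv_nonzero: "\<And>x. x \<ge> 1 \<Longrightarrow> f' x \<noteq> 0"
    and integral_limit:
      "filterlim (\<lambda>n::nat. integral {1..real n} (\<lambda>t. B t * f' t)) at_top sequentially \<or>
       filterlim (\<lambda>n::nat. integral {1..real n} (\<lambda>t. B t * f' t)) at_bot sequentially"
  shows "(\<lambda>n::nat. (\<Sum>k=1..n. a k * f (real k)) / (\<Sum>k=1..n. b k * f (real k)))
           \<longlonglongrightarrow> 1"
proof -
  define A' where "A' = (\<lambda>n. \<Sum>k=1..n. a k)"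
  define B' where "B' = (\<lambda>n. \<Sum>k=1..n. b k)"
  define \<Delta> where "\<Delta> = (\<lambda>k. f (real (Suc k)) - f (real k))"
  define I where "I = (\<lambda>n. \<Sum>k=1..<n. B' k * \<Delta> k)"
  define J where "J = (\<lambda>n. \<Sum>k=1..<n. A' k * \<Delta> k)"
  have BB': "B (real n) = B' n" for n by (simp add: B_def B'_def)
  have int: "integral {1..real n} (\<lambda>t. B t * f' t) = I n" if "n > 0" for n
    using integral_unique[OF integral_step_function_deriv[OF deriv that, of b]]
    by (simp only: B_def I_def B'_def \<Delta>_def)
  have ev: "\<forall>\<^sub>F n in sequentially. integral {1..real n} (\<lambda>t. B t * f' t) = I n"
    using eventually_gt_at_top[of 0] by eventually_elim (rule int)
  have "filterlim I at_top sequentially \<or> filterlim I at_bot sequentially"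
    using integral_limit filterlim_cong[OF refl refl ev, of at_top] filterlim_cong[OF refl refl ev, of at_bot] by blast
  then have I: "filterlim (\<lambda>n. \<bar>I n\<bar>) at_top sequentially"
  proof
    assume "filterlim I at_top sequentially"
    then show ?thesis by (rule filterlim_at_top_mono) (intro always_eventually allI abs_ge_self)
  next
    assume "filterlim I at_bot sequentially"
    then have "filterlim (\<lambda>n. - I n) at_top sequentially" by (simp add: filterlim_uminus_at_top)
    then show ?thesis by (rule filterlim_at_top_mono) (intro always_eventually allI abs_ge_minus_self)
  qed
  obtain L :: ereal where L: "L \<noteq> 1"
      "(\<lambda>n::nat. ereal (integral {1..real n} (\<lambda>t. B t * f' t) / (B (real n) * f (real n)))) \<longlonglongrightarrow> L"
    using ratio_limit by blast
  have L': "(\<lambda>n. ereal (I n / (B' n * f (real n)))) \<longlonglongrightarrow> L"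
    by (rule Lim_transform_eventually[OF L(2)]) (use ev in eventually_elim, simp add: BB')
  have B'_nonneg: "B' n \<ge> 0" for n
    unfolding B'_def by (intro sum_nonneg) (simp add: b_def)
  have B'_pos: "\<forall>\<^sub>F n in sequentially. B' n > 0"
    using filterlim_at_top_dense[THEN iffD1, OF prime_number_theorem(1), rule_format, of 0] by (simp add: B'_def)
  have AB: "(\<lambda>n. (A' n - B' n) / B' n) \<longlonglongrightarrow> 0"
    using prime_number_theorem(2) by (simp add: A'_def B'_def)
  have "(\<forall>k\<ge>1. \<Delta> k \<ge> 0) \<or> (\<forall>k\<ge>1. \<Delta> k \<le> 0)"
    using monotone by (auto simp: \<Delta>_def monotone_on_def)
  then have JI: "(\<lambda>n. (J n - I n) / I n) \<longlonglongrightarrow> 0"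
    unfolding I_def J_def by (intro monotone_weights_ratio B'_nonneg B'_pos AB I[unfolded I_def])
  have I0: "\<forall>\<^sub>F n in sequentially. I n \<noteq> 0"
    using filterlim_at_top_dense[THEN iffD1, OF I, rule_format, of 0] by eventually_elim auto
  have "(\<lambda>n. (A' n * f (real n) - J n) / (B' n * f (real n) - I n)) \<longlonglongrightarrow> 1"
  proof (rule ratio_of_differences[OF L' L(1) I0 AB _ JI])
    show "\<forall>\<^sub>F n in sequentially. A' n * f (real n) - B' n * f (real n) = (A' n - B' n) / B' n * (B' n * f (real n))"
      using B'_pos by eventually_elim (simp add: field_simps)
    show "\<forall>\<^sub>F n in sequentially. J n - I n = (J n - I n) / I n * I n"
      using I0 by eventually_elim simp
  qed
  then show ?thesis
  proof (rule Lim_transform_eventually)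
    show "\<forall>\<^sub>F n in sequentially. (A' n * f (real n) - J n) / (B' n * f (real n) - I n)
        = (\<Sum>k=1..n. a k * f (real k)) / (\<Sum>k=1..n. b k * f (real k))"
      using eventually_gt_at_top[of 0]
      by eventually_elim
        (simp only: abel_summation_differences[of _ a "\<lambda>k. f (real k)"] abel_summation_differences[of _ b "\<lambda>k. f (real k)"]
           A'_def B'_def I_def J_def \<Delta>_def)
  qed
qed

end
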